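(* Let $X$ be a metrizable space and $n,k,m,m_1,m_2$ be non-negative integers or infinity. (1) If $m=m_1+m_2+1$ and $X$ has simultaneously the $0$-$\overline{\mathrm{DD}}{}^{\{n+m_1,k+m_2\}}$-property, the $m_1$-$\overline{\mathrm{DD}}{}^{\{n,k+m-m_1\}}$-property and the $m_2$-$\overline{\mathrm{DD}}{}^{\{n+m-m_2,k\}}$-property, then $X$ has the $m$-$\overline{\mathrm{DD}}{}^{\{n,k\}}$-property. Here $m-m_1$ is read as $m_2+1$ and $m-m_2$ as $m_1+1$. (2) If $X$ has the $0$-$\overline{\mathrm{DD}}{}^{\{n,k+m+1\}}$-property and the $m$-$\overline{\mathrm{DD}}{}^{\{n+1,k\}}$-property, then $X$ has the $(m+1)$-$\overline{\mathrm{DD}}{}^{\{n,k\}}$-property. (3) If $X$ has the $0$-$\overline{\mathrm{DD}}{}^{\{n+i,k+j\}}$-property for all $i,j\in\{0,1,2,\dots\}$ with $i+j<m+1$, then $X$ has the $m$-$\overline{\mathrm{DD}}{}^{\{n,k\}}$-property.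
   Context: All maps are continuous. $\infty+\infty=\infty+n=n+\infty=\infty-n=\infty$ for finite $n$. $\mathbb I=[0,1]$ and $\mathbb I^\infty$ is the Hilbert cube. Two maps $f,g:K\to X$ are $\mathcal U$-homotopic, for a cover $\mathcal U$ of $X$, if there is a homotopy $h:K\times[0,1]\to X$ from $f$ to $g$ such that for each $x\in K$ the set $h(\{x\}\times[0,1])$ lies in some $U\in\mathcal U$. For $m,n,k$ non-negative integers or $\infty$, a space $X$ has the $m$-$\overline{\mathrm{DD}}{}^{\{n,k\}}$-property if for any open cover $\mathcal U$ of $X$ and any maps $f:\mathbb I^m\times\mathbb I^n\to X$, $g:\mathbb I^m\times\mathbb I^k\to X$ there are maps $f':\mathbb I^m\times\mathbb I^n\to X$, $g':\mathbb I^m\times\mathbb I^k\to X$ such that $f'$ is $\mathcal U$-homotopic to $f$, $g'$ is $\mathcal U$-homotopic to $g$, and $f'(\{z\}\times\mathbb I^n)\cap g'(\{z\}\times\mathbb I^k)=\varnothing$ for all $z\in\mathbb I^m$. *)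

theory Defs
  imports "HOL-Analysis.Analysis"
begin

(* The index set consists of the naturals below d, so d = 0 gives a one-point space,
   finite d the usual d-cube, and d = \<infinity> the Hilbert cube. *)
definition unit_cube :: "enat \<Rightarrow> (nat \<Rightarrow> real) topology" where
  "unit_cube d = product_topology (\<lambda>_. top_of_set {0..1}) {i. enat i < d}"

definition open_cover_of :: "'a topology \<Rightarrow> 'a set set \<Rightarrow> bool" where
  "open_cover_of X \<U> \<longleftrightarrow> (\<forall>U\<in>\<U>. openin X U) \<and> \<Union>\<U> = topspace X"

(* The library's homotopic_with puts the parameter interval first and cannot bound the
   individual tracks of the homotopy, hence this separate definition. *)
definition cover_homotopic ::
  "'k topology \<Rightarrow> 'a topology \<Rightarrow> 'a set set \<Rightarrow> ('k \<Rightarrow> 'a) \<Rightarrow> ('k \<Rightarrow> 'a) \<Rightarrow> bool" where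
  "cover_homotopic K X \<U> f g \<longleftrightarrow>
     (\<exists>h. continuous_map (prod_topology K (top_of_set {0..1::real})) X h \<and>
          (\<forall>x\<in>topspace K. h (x, 0) = f x) \<and>
          (\<forall>x\<in>topspace K. h (x, 1) = g x) \<and>
          (\<forall>x\<in>topspace K. \<exists>U\<in>\<U>. h ` ({x} \<times> {0..1}) \<subseteq> U))"

definition DD_property :: "enat \<Rightarrow> enat \<Rightarrow> enat \<Rightarrow> 'a topology \<Rightarrow> bool" where
  "DD_property m n k X \<longleftrightarrow>
     (\<forall>\<U> f g.
        open_cover_of X \<U> \<longrightarrow>
        continuous_map (prod_topology (unit_cube m) (unit_cube n)) X f \<longrightarrow>
        continuous_map (prod_topology (unit_cube m) (unit_cube k)) X g \<longrightarrow>
        (\<exists>f' g'.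
           continuous_map (prod_topology (unit_cube m) (unit_cube n)) X f' \<and>
           continuous_map (prod_topology (unit_cube m) (unit_cube k)) X g' \<and>
           cover_homotopic (prod_topology (unit_cube m) (unit_cube n)) X \<U> f' f \<and>
           cover_homotopic (prod_topology (unit_cube m) (unit_cube k)) X \<U> g' g \<and>
           (\<forall>z\<in>topspace (unit_cube m).
              f' ` ({z} \<times> topspace (unit_cube n)) \<inter> g' ` ({z} \<times> topspace (unit_cube k)) = {})))"

end

theory Submission
  imports Defs
begin

text \<open>
  All maps are transferred to the space of real sequences, and the property becomes: any two maps
  can be moved by small homotopies so that they become disjoint over a given compact set of pairs,
  namely the pairs of points in two coordinate subspaces which agree in the parameter coordinates.
  Working with homotopies makes extension from subspaces possible for an arbitrary target.

  Write the parameter cube, with a fine cubical lattice, locally as a join of the \<open>m1\<close>-dimensional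
  skeleton (at least \<open>m2 + 1\<close> coordinates even) and the \<open>m2\<close>-dimensional dual skeleton (at least
  \<open>m1 + 1\<close> coordinates odd). The join parameter \<open>c\<close> of a point is the \<open>(m2 + 1)\<close>-st smallest
  distance of its coordinates to the even integers. The \<open>0\<close>-dimensional property separates the images
  over the two skeleta, hence also over small neighbourhoods of them. Then precompose the first map with
  \<open>c \<mapsto> max 0 (2c - 1)\<close> and the second with \<open>c \<mapsto> min 1 (2c)\<close>. Where \<open>c \<le> 1/2\<close> the first map
  only sees the skeleton, while the second sees a cone over the dual skeleton, fibred over the skeleton
  with fibres of dimension \<open>m2 + 1\<close>, so the second property applies away from the dual skeleton.
  The case \<open>c \<ge> 1/2\<close> is dual.

  Infinite dimensions are reduced to finite ones by truncating sequences, the second formula is the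
  case \<open>m1 = 0\<close> of the first, and the third follows from the second by induction.
\<close>

section \<open>Small homotopies of maps on real sequences\<close>

text \<open>The order of the separations is forced. The cone seen by one map shrinks to points over
  the opposite skeleton, so it becomes a homeomorphic image of a product only after being cut off at
  some distance \<eta> from there, and what is cut off must already be safe. Hence the pairs of
  skeleta come first; compactness turns disjointness into a positive distance, which yields \<eta>
  and a bound \<mu> on all later moves; only then are the cones defined. The cones are products
  because of one computation. Outside the flattened coordinates the two reparametrized points lie on
  a common ray from the odd lattice point \<open>m\<close>, with distances in the ratio 1 to 1 - 2c,
  while 2c is the largest distance of the flattened coordinates of the second point from
  \<open>l\<close>. So the ratio can be read off from the second point alone. Only finitely many
  lattice points matter for a bounded cube, and separations over finitely many compact sets can be
  carried out one after another, each within the margin left by the earlier ones.\<close>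

definition cube :: "real \<Rightarrow> (nat \<Rightarrow> real) set"
  where "cube b = {x. \<forall>i. \<bar>x i\<bar> \<le> b}"

lemma cubeD: "x \<in> cube b \<Longrightarrow> \<bar>x i\<bar> \<le> b"
  by (simp add: cube_def)

lemma cube_mono: "a \<le> b \<Longrightarrow> cube a \<subseteq> cube b"
  by (auto simp: cube_def intro: order_trans)

lemma compact_cube: "compact (cube b)"
proof -
  have "cube b = PiE UNIV (\<lambda>_. {-b..b})"
    by (auto simp: cube_def PiE_def Pi_def abs_le_iff minus_le_iff)
  moreover have "compactin (product_topology (\<lambda>_::nat. euclideanreal) UNIV) (PiE UNIV (\<lambda>_. {-b..b}))"
    by (subst compactin_PiE) (simp add: compactin_euclidean_iff)
  ultimately show ?thesis
    by (metis compactin_euclidean_iff euclidean_product_topology)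
qed

lemma dist_fun_small:
  fixes e :: real
  assumes "e > 0"
  obtains T \<delta> where "\<delta> > 0"
    "\<forall>x y :: nat \<Rightarrow> real. (\<forall>i<T. \<bar>x i - y i\<bar> \<le> \<delta>) \<longrightarrow> dist x y < e"
proof -
  obtain N where N: "(1/2::real) ^ N < e/2"
    using real_arch_pow_inv[of "e/2" "1/2"] assms by auto
  \<comment> \<open>The distance enumerates coordinates through \<open>from_nat\<close>, so
    \<open>T\<close> must exceed every index met up to \<open>N\<close>. The estimate by twice the
    maximum plus \<open>(1/2) ^ N\<close> explains \<open>e/8\<close>.\<close>
  define T where "T = Suc (Max ((from_nat :: nat \<Rightarrow> nat) ` {..N}))"
  have "dist x y < e" if *: "\<forall>i<T. \<bar>x i - y i\<bar> \<le> e/8" for x y :: "nat \<Rightarrow> real"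
  proof -
    let ?A = "{dist (x (from_nat n)) (y (from_nat n)) |n. n \<le> N}"
    have eq: "?A = (\<lambda>n. dist (x (from_nat n)) (y (from_nat n))) ` {..N}"
      by auto
    have "dist (x (from_nat n)) (y (from_nat n)) \<le> e/8" if "n \<le> N" for n
      using that *[THEN spec, of "from_nat n"] by (simp add: dist_real_def T_def less_Suc_eq_le)
    then have "Max ?A \<le> e/8"
      unfolding eq by (subst Max_le_iff) auto
    then show ?thesis
      using dist_fun_le_dist_first_terms[of x y N] N assms by linarith
  qed
  with that[of "e/8" T] assms show ?thesis by auto
qed

context Metric_space begin

lemma continuous_map_dist:
  assumes "continuous_map Y mtopology f" "continuous_map Y mtopology g"
  shows "continuous_map Y euclideanreal (\<lambda>x. d (f x) (g x))"
proof -
  have "mtopology_of (metric (M,d)) = mtopology" "mdist (metric (M,d)) = d"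
    by (simp_all add: mtopology_of_def Metric_space_axioms)
  with continuous_map_mdist[of Y "metric (M,d)" f g] assms show ?thesis
    by simp
qed

lemma cont_in_M: "continuous_map euclidean mtopology f \<Longrightarrow> f x \<in> M"
  using continuous_map_image_subset_topspace[of euclidean mtopology f] by auto

lemma cont_compose:
  "continuous_map euclidean mtopology f \<Longrightarrow> continuous_on UNIV a \<Longrightarrow> continuous_map euclidean mtopology (\<lambda>x. f (a x))"
  using continuous_map_compose[of euclidean euclidean a mtopology f] by (simp add: o_def)

lemma cont_lift:
  assumes "continuous_on UNIV a"
  shows "continuous_on UNIV (\<lambda>p :: (nat \<Rightarrow> real) \<times> real. a (fst p))"
  by (rule continuous_on_compose2[OF assms]) (auto intro: continuous_on_fst continuous_on_id)

text \<open>Uniform continuity of the real function \<open>F\<close> on a compact square of cubes,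
  applied at \<open>(x,y)\<close> and at the diagonal point \<open>(x,x)\<close>, where
  \<open>F\<close> vanishes. That finitely many coordinates suffice is what later permits
  truncation.\<close>

lemma uniform_on_cube:
  assumes f: "continuous_map euclidean mtopology (f :: (nat \<Rightarrow> real) \<Rightarrow> 'a)" and "e > 0"
  obtains T \<delta> where "\<delta> > 0"
    "\<forall>x\<in>cube b. \<forall>y\<in>cube b. (\<forall>i<T. \<bar>x i - y i\<bar> \<le> \<delta>) \<longrightarrow> d (f x) (f y) < e"
proof -
  define F where "F p = d (f (fst p)) (f (snd p))" for p
  have "continuous_map euclidean euclideanreal F"
    unfolding F_def by (intro continuous_map_dist cont_compose[OF f] continuous_intros)
  then have "continuous_on UNIV F"
    by simp
  then have uc: "uniformly_continuous_on (cube b \<times> cube b) F"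
    by (intro compact_uniformly_continuous compact_Times compact_cube) (auto elim: continuous_on_subset)
  obtain r where "r > 0" and
    r: "\<forall>p\<in>cube b \<times> cube b. \<forall>q\<in>cube b \<times> cube b. dist q p < r \<longrightarrow> dist (F q) (F p) < e"
    using uc[unfolded uniformly_continuous_on_def, THEN spec, THEN mp, OF \<open>e > 0\<close>]
    by (elim exE conjE) (rule that)
  obtain T \<delta> where "\<delta> > 0" and
    T: "\<forall>x y :: nat \<Rightarrow> real. (\<forall>i<T. \<bar>x i - y i\<bar> \<le> \<delta>) \<longrightarrow> dist x y < r"
    by (rule dist_fun_small[OF \<open>r > 0\<close>]) (rule that)
  have "d (f x) (f y) < e" if "x \<in> cube b" "y \<in> cube b" "\<forall>i<T. \<bar>x i - y i\<bar> \<le> \<delta>" for x y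
  proof -
    have "dist (x,y) (x,x) < r"
      using T that(3) by (simp add: dist_Pair_Pair dist_commute[of y x])
    then have "dist (d (f x) (f y)) (d (f x) (f x)) < e"
      using r[THEN bspec, THEN bspec, of "(x,x)" "(x,y)"] that by (simp add: F_def)
    moreover have "d (f x) (f x) = 0"
      using cont_in_M[OF f] by simp
    ultimately show ?thesis
      by (simp add: dist_real_def)
  qed
  then show ?thesis by (intro that[OF \<open>\<delta> > 0\<close>]) blast
qed

text \<open>Homotopies live on all sequences and all real times, so that they can be composed as
  total functions; smallness is asked only on a cube and for times in [0,1], where compactness is
  available.\<close>

definition close_homotopic ::
  "((nat \<Rightarrow> real) \<Rightarrow> 'a) \<Rightarrow> ((nat \<Rightarrow> real) \<Rightarrow> 'a) \<Rightarrow> real \<Rightarrow> real \<Rightarrow> bool" where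
  "close_homotopic f f' e b \<longleftrightarrow>
     (\<exists>h. continuous_map (euclidean :: ((nat \<Rightarrow> real) \<times> real) topology) mtopology h \<and>
       (\<forall>x. h (x, 0) = f x) \<and> (\<forall>x. h (x, 1) = f' x) \<and>
       (\<forall>x\<in>cube b. \<forall>t\<in>{0..1}. d (f x) (h (x, t)) < e))"

lemma close_homotopic_cont:
  assumes "close_homotopic f f' e b"
  shows "continuous_map euclidean mtopology f" "continuous_map euclidean mtopology f'"
proof -
  obtain h where h: "continuous_map (euclidean :: ((nat \<Rightarrow> real) \<times> real) topology) mtopology h"
       "f = (\<lambda>x. h (x,0))" "f' = (\<lambda>x. h (x,1))"
    using assms unfolding close_homotopic_def by (metis ext)
  show "continuous_map euclidean mtopology f" "continuous_map euclidean mtopology f'"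
    unfolding h(2,3) by (auto intro!: cont_compose[OF h(1)] continuous_intros)
qed

lemma close_homotopic_mono:
  "close_homotopic f f' e b \<Longrightarrow> e \<le> e' \<Longrightarrow> b' \<le> b \<Longrightarrow> close_homotopic f f' e' b'"
  unfolding close_homotopic_def using cube_mono[of b' b] by (meson less_le_trans subset_iff)

lemma close_homotopicD:
  "close_homotopic f f' e b \<Longrightarrow> x \<in> cube b \<Longrightarrow> d (f x) (f' x) < e"
  unfolding close_homotopic_def by (metis atLeastAtMost_iff order_refl zero_le_one)

lemma close_homotopic_refl:
  assumes "continuous_map euclidean mtopology f" "e > 0"
  shows "close_homotopic f f e b"
  unfolding close_homotopic_def
proof (intro exI conjI)
  show "continuous_map euclidean mtopology (\<lambda>p :: (nat \<Rightarrow> real) \<times> real. f (fst p))"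
    by (intro cont_compose[OF assms(1)] continuous_on_fst continuous_on_id)
qed (use cont_in_M[OF assms(1)] assms(2) in auto)

lemma close_homotopic_trans:
  assumes "close_homotopic f g e b" "close_homotopic g h e' b"
  shows "close_homotopic f h (e + e') b"
proof -
  obtain H where H: "continuous_map (euclidean :: ((nat \<Rightarrow> real) \<times> real) topology) mtopology H"
    "\<And>x. H (x,0) = f x" "\<And>x. H (x,1) = g x" "\<And>x t. x \<in> cube b \<Longrightarrow> t \<in> {0..1} \<Longrightarrow> d (f x) (H (x,t)) < e"
    using assms(1) unfolding close_homotopic_def by metis
  obtain G where G: "continuous_map (euclidean :: ((nat \<Rightarrow> real) \<times> real) topology) mtopology G"
    "\<And>x. G (x,0) = g x" "\<And>x. G (x,1) = h x" "\<And>x t. x \<in> cube b \<Longrightarrow> t \<in> {0..1} \<Longrightarrow> d (g x) (G (x,t)) < e'"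
    using assms(2) unfolding close_homotopic_def by metis
  define K where "K p = (if snd p \<le> 1/2 then H (fst p, 2 * snd p) else G (fst p, 2 * snd p - 1))" for p
  have 1: "continuous_map (euclidean :: ((nat \<Rightarrow> real) \<times> real) topology) mtopology K"
    unfolding K_def
  proof (intro continuous_map_cases_le continuous_map_from_subtopology cont_compose[OF H(1)] cont_compose[OF G(1)])
    show "H (fst p, 2 * snd p) = G (fst p, 2 * snd p - 1)" if "snd p = 1/2" for p
    proof -
      have "2 * snd p = 1" "2 * snd p - 1 = 0"
        using that by simp_all
      then show ?thesis
        by (simp only: H(3) G(2))
    qed
  qed (auto intro!: continuous_on_Pair continuous_on_fst continuous_on_snd continuous_on_id
         continuous_on_mult_left continuous_on_diff continuous_on_const)
  have 2: "d (f x) (K (x,t)) < e + e'" if "x \<in> cube b" "t \<in> {0..1}" for x t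
  proof (cases "t \<le> 1/2")
    case True
    have "d (f x) (H (x, 2*t)) < e" "d (g x) (G (x, 0)) < e'"
      using H(4)[of x "2*t"] G(4)[of x 0] that True by auto
    then show ?thesis
      using True le_less_trans[OF nonneg[of "g x" "G (x,0)"]] by (force simp: K_def)
  next
    case False
    have "d (f x) (g x) < e" "d (g x) (G (x,2*t-1)) < e'"
      using H(4)[of x 1] G(4)[of x "2*t-1"] H(3) that False by auto
    moreover have "d (f x) (G (x,2*t-1)) \<le> d (f x) (g x) + d (g x) (G (x,2*t-1))"
      by (intro triangle cont_in_M[OF G(1)] cont_in_M[OF close_homotopic_cont(1)[OF assms(1)]]
            cont_in_M[OF close_homotopic_cont(2)[OF assms(1)]])
    ultimately show ?thesis
      using False by (simp add: K_def)
  qed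
  show ?thesis
    unfolding close_homotopic_def using 1 2 H G by (intro exI[of _ K]) (auto simp: K_def)
qed

lemma close_homotopic_precompose:
  assumes "close_homotopic f f' e b" "continuous_on UNIV a" "\<And>x. x \<in> cube b' \<Longrightarrow> a x \<in> cube b"
  shows "close_homotopic (\<lambda>x. f (a x)) (\<lambda>x. f' (a x)) e b'"
proof -
  obtain H where H: "continuous_map (euclidean :: ((nat \<Rightarrow> real) \<times> real) topology) mtopology H"
    "\<And>x. H (x,0) = f x" "\<And>x. H (x,1) = f' x" "\<And>x t. x \<in> cube b \<Longrightarrow> t \<in> {0..1} \<Longrightarrow> d (f x) (H (x,t)) < e"
    using assms(1) unfolding close_homotopic_def by metis
  show ?thesis
    unfolding close_homotopic_def
  proof (intro exI conjI)
    show "continuous_map euclidean mtopology (\<lambda>p. H (a (fst p), snd p))"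
      by (intro cont_compose[OF H(1)] continuous_on_Pair cont_lift assms(2) continuous_on_snd continuous_on_id)
  qed (use H assms in auto)
qed

text \<open>A straight line from \<open>x\<close> to \<open>a x\<close> in the domain, followed by
  \<open>f\<close>; this works in any target.\<close>

lemma close_homotopic_reparam:
  assumes f: "continuous_map euclidean mtopology f"
    and a: "continuous_on UNIV a"
    and small: "\<And>x t. x \<in> cube b \<Longrightarrow> t \<in> {0..1} \<Longrightarrow> d (f x) (f (\<lambda>i. (1-t) * x i + t * a x i)) < e"
  shows "close_homotopic f (\<lambda>x. f (a x)) e b"
  unfolding close_homotopic_def
proof (intro exI conjI)
  let ?A = "\<lambda>p::(nat \<Rightarrow> real) \<times> real. \<lambda>i. (1 - snd p) * fst p i + snd p * a (fst p) i"
  have co: "continuous_on UNIV (\<lambda>p::(nat \<Rightarrow> real) \<times> real. fst p i)"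
    "continuous_on UNIV (\<lambda>p::(nat \<Rightarrow> real) \<times> real. a (fst p) i)" for i
    by (rule continuous_on_product_then_coordinatewise[OF continuous_on_fst[OF continuous_on_id]]
        continuous_on_product_then_coordinatewise[OF cont_lift[OF a]])+
  show "continuous_map euclidean mtopology (\<lambda>p. f (?A p))"
    by (intro cont_compose[OF f] continuous_on_coordinatewise_then_product continuous_on_add continuous_on_mult
         continuous_on_diff continuous_on_const continuous_on_snd continuous_on_id co)
qed (use small in auto)

section \<open>Separation of two maps over a set of pairs\<close>

lemma positive_margin:
  fixes E :: "((nat \<Rightarrow> real) \<times> (nat \<Rightarrow> real)) set"
  assumes f: "continuous_map euclidean mtopology f" and g: "continuous_map euclidean mtopology g"
    and E: "compact E" "\<And>x y. (x,y) \<in> E \<Longrightarrow> f x \<noteq> g y"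
  obtains \<mu> where "\<mu> > 0" "\<And>x y. (x,y) \<in> E \<Longrightarrow> \<mu> \<le> d (f x) (g y)"
proof (cases "E = {}")
  case True
  then show ?thesis using that[of 1] by auto
next
  case False
  define F where "F p = d (f (fst p)) (g (snd p))" for p
  have "continuous_map euclidean euclideanreal F"
    unfolding F_def by (intro continuous_map_dist cont_compose[OF f] cont_compose[OF g] continuous_intros)
  then have "continuous_on E F"
    by (auto elim: continuous_on_subset)
  then obtain p where p: "p \<in> E" "\<And>q. q \<in> E \<Longrightarrow> F p \<le> F q"
    using continuous_attains_inf[OF E(1) False] by metis
  have "F p > 0"
    using E(2)[of "fst p" "snd p"] p(1) cont_in_M[OF f] cont_in_M[OF g] by (simp add: F_def)
  moreover have "F p \<le> d (f x) (g y)" if "(x,y) \<in> E" for x y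
    using p(2)[OF that] by (simp add: F_def)
  ultimately show ?thesis by (rule that)
qed

text \<open>The bound \<open>b\<close> is independent of \<open>E\<close>, so that smallness can be
  demanded on a cube as large as later steps require.\<close>

definition can_separate :: "((nat \<Rightarrow> real) \<times> (nat \<Rightarrow> real)) set \<Rightarrow> bool" where
  "can_separate E \<longleftrightarrow> (\<forall>f g e b. continuous_map euclidean mtopology f \<longrightarrow> continuous_map euclidean mtopology g \<longrightarrow> e > 0 \<longrightarrow>
     (\<exists>f' g'. close_homotopic f f' e b \<and> close_homotopic g g' e b \<and> (\<forall>(x,y)\<in>E. f' x \<noteq> g' y)))"

lemma can_separateD:
  assumes "can_separate E" "continuous_map euclidean mtopology f" "continuous_map euclidean mtopology g" "e > 0"
  obtains f' g' where "close_homotopic f f' e b" "close_homotopic g g' e b"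
    "\<And>x y. (x,y) \<in> E \<Longrightarrow> f' x \<noteq> g' y"
  using assms unfolding can_separate_def by fast

lemma can_separate_converse:
  assumes "can_separate E"
  shows "can_separate (E\<inverse>)"
  unfolding can_separate_def
proof (intro allI impI)
  fix f g :: "(nat \<Rightarrow> real) \<Rightarrow> 'a" and e b :: real
  assume fg: "continuous_map euclidean mtopology f" "continuous_map euclidean mtopology g" "e > 0"
  obtain g' f' where "close_homotopic g g' e b" "close_homotopic f f' e b"
      "\<And>x y. (x,y) \<in> E \<Longrightarrow> g' x \<noteq> f' y"
    using can_separateD[OF assms fg(2,1,3)] by blast
  then show "\<exists>f' g'. close_homotopic f f' e b \<and> close_homotopic g g' e b \<and> (\<forall>(x,y)\<in>E\<inverse>. f' x \<noteq> g' y)"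
    by (intro exI[of _ f'] exI[of _ g']) (fastforce simp: eq_commute)
qed

lemma can_separate_empty: "can_separate {}"
  unfolding can_separate_def using close_homotopic_refl by blast

text \<open>Compactness leaves a margin \<mu> over \<open>E1\<close> once it is separated; moves
  below \<open>\<mu>/2\<close> made for \<open>E2\<close> cannot use it up. They are kept small on
  \<open>cube c\<close> as well, since that is where \<open>E1\<close> lives.\<close>

lemma can_separate_Un:
  assumes "can_separate E1" "can_separate E2" "compact E1" "E1 \<subseteq> cube c \<times> cube c"
  shows "can_separate (E1 \<union> E2)"
  unfolding can_separate_def
proof (intro allI impI)
  fix f g :: "(nat \<Rightarrow> real) \<Rightarrow> 'a" and e b :: real
  assume fg: "continuous_map euclidean mtopology f" "continuous_map euclidean mtopology g" "e > 0"
  obtain f1 g1 where 1: "close_homotopic f f1 (e/2) b" "close_homotopic g g1 (e/2) b"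
    "\<And>x y. (x,y) \<in> E1 \<Longrightarrow> f1 x \<noteq> g1 y"
    using can_separateD[OF assms(1) fg(1,2), of "e/2" b] fg(3) by auto
  note c1 = close_homotopic_cont(2)[OF 1(1)] close_homotopic_cont(2)[OF 1(2)]
  obtain \<mu> where \<mu>: "\<mu> > 0" "\<And>x y. (x,y) \<in> E1 \<Longrightarrow> \<mu> \<le> d (f1 x) (g1 y)"
    using positive_margin[OF c1 assms(3) 1(3)] by blast
  obtain f2 g2 where 2: "close_homotopic f1 f2 (min (e/2) (\<mu>/2)) (max b c)"
    "close_homotopic g1 g2 (min (e/2) (\<mu>/2)) (max b c)"
    "\<And>x y. (x,y) \<in> E2 \<Longrightarrow> f2 x \<noteq> g2 y"
    using can_separateD[OF assms(2) c1, of "min (e/2) (\<mu>/2)" "max b c"] fg(3) \<mu> by auto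
  note c2 = close_homotopic_cont(2)[OF 2(1)] close_homotopic_cont(2)[OF 2(2)]
  have "f2 x \<noteq> g2 y" if "(x,y) \<in> E1" for x y
  proof
    assume eq: "f2 x = g2 y"
    have "x \<in> cube (max b c)" "y \<in> cube (max b c)"
      using that assms(4) cube_mono[of c "max b c"] by auto
    then have "d (f1 x) (f2 x) < \<mu>/2" "d (g1 y) (g2 y) < \<mu>/2"
      using close_homotopicD[OF 2(1)] close_homotopicD[OF 2(2)] by auto
    moreover have "d (f1 x) (g1 y) \<le> d (f1 x) (f2 x) + d (g1 y) (g2 y)"
      using triangle[of "f1 x" "f2 x" "g1 y"] cont_in_M[OF c1(1)] cont_in_M[OF c1(2)] cont_in_M[OF c2(1)] cont_in_M[OF c2(2)] eq
        commute[of "g1 y" "g2 y"] by simp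
    ultimately show False using \<mu>(2)[OF that] by linarith
  qed
  moreover have "close_homotopic f f2 e b" "close_homotopic g g2 e b"
    using close_homotopic_trans[OF 1(1) close_homotopic_mono[OF 2(1)], of "e/2"]
      close_homotopic_trans[OF 1(2) close_homotopic_mono[OF 2(2)], of "e/2"] by auto
  ultimately show "\<exists>f' g'. close_homotopic f f' e b \<and> close_homotopic g g' e b \<and> (\<forall>(x,y)\<in>E1 \<union> E2. f' x \<noteq> g' y)"
    using 2(3) by blast
qed

lemma can_separate_UN:
  assumes "finite I" "\<And>i. i \<in> I \<Longrightarrow> can_separate (E i)" "\<And>i. i \<in> I \<Longrightarrow> compact (E i)"
    "\<And>i. i \<in> I \<Longrightarrow> E i \<subseteq> cube c \<times> cube c"
  shows "can_separate (\<Union>i\<in>I. E i)"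
  using assms
proof (induction I)
  case (insert i I)
  then show ?case using can_separate_Un[of "E i" "\<Union>i\<in>I. E i" c] by auto
qed (simp add: can_separate_empty)

text \<open>Precompose with the homeomorphisms, separate over \<open>E\<close>, and undo them. The
  inverses must send cubes into cubes because smallness is controlled on cubes only.\<close>

lemma can_separate_image:
  assumes "can_separate E"
    and \<phi>: "continuous_on UNIV \<phi>" "continuous_on UNIV \<phi>'" "\<And>x. \<phi>' (\<phi> x) = x" "\<And>x. \<phi> (\<phi>' x) = x"
       "\<And>b. \<exists>c. \<forall>x\<in>cube b. \<phi>' x \<in> cube c"
    and \<psi>: "continuous_on UNIV \<psi>" "continuous_on UNIV \<psi>'" "\<And>x. \<psi>' (\<psi> x) = x" "\<And>x. \<psi> (\<psi>' x) = x"
       "\<And>b. \<exists>c. \<forall>x\<in>cube b. \<psi>' x \<in> cube c"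
  shows "can_separate ((\<lambda>(x,y). (\<phi> x, \<psi> y)) ` E)"
  unfolding can_separate_def
proof (intro allI impI)
  fix f g :: "(nat \<Rightarrow> real) \<Rightarrow> 'a" and e b :: real
  assume fg: "continuous_map euclidean mtopology f" "continuous_map euclidean mtopology g" "e > 0"
  obtain c1 where c1: "\<forall>x\<in>cube b. \<phi>' x \<in> cube c1"
    using \<phi>(5)[of b] by blast
  obtain c2 where c2: "\<forall>x\<in>cube b. \<psi>' x \<in> cube c2"
    using \<psi>(5)[of b] by blast
  define c where "c = max c1 c2"
  have c: "\<And>x. x \<in> cube b \<Longrightarrow> \<phi>' x \<in> cube c" "\<And>x. x \<in> cube b \<Longrightarrow> \<psi>' x \<in> cube c"
    using c1 c2 cube_mono[of c1 c] cube_mono[of c2 c] by (auto simp: c_def)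
  obtain f' g' where *: "close_homotopic (\<lambda>x. f (\<phi> x)) f' e c" "close_homotopic (\<lambda>x. g (\<psi> x)) g' e c"
    "\<And>x y. (x,y) \<in> E \<Longrightarrow> f' x \<noteq> g' y"
    by (rule can_separateD[OF assms(1) cont_compose[OF fg(1) \<phi>(1)] cont_compose[OF fg(2) \<psi>(1)] fg(3), of c]) (rule that)
  have "close_homotopic f (\<lambda>x. f' (\<phi>' x)) e b" "close_homotopic g (\<lambda>x. g' (\<psi>' x)) e b"
    using close_homotopic_precompose[OF *(1) \<phi>(2) c(1)] close_homotopic_precompose[OF *(2) \<psi>(2) c(2)]
    by (simp_all add: \<phi> \<psi>)
  then show "\<exists>f' g'. close_homotopic f f' e b \<and> close_homotopic g g' e b \<and>
      (\<forall>(x,y)\<in>(\<lambda>(x,y). (\<phi> x, \<psi> y)) ` E. f' x \<noteq> g' y)"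
    by (intro exI[of _ "\<lambda>x. f' (\<phi>' x)"] exI[of _ "\<lambda>x. g' (\<psi>' x)"]) (auto simp: \<phi> \<psi> *)
qed

end

section \<open>From the disjoint disks property to separation\<close>

text \<open>\<open>P\<close> carries the common parameter, \<open>N\<close> and \<open>K\<close> the
  two fibres. The points \<open>x\<close> and \<open>y\<close> lie in separate copies of the
  sequence space, so \<open>N\<close> and \<open>K\<close> may overlap; with \<open>P\<close> empty,
  \<open>x\<close> and \<open>y\<close> vary independently.\<close>

definition fibre_pairs :: "nat set \<Rightarrow> nat set \<Rightarrow> nat set \<Rightarrow> real \<Rightarrow> ((nat \<Rightarrow> real) \<times> (nat \<Rightarrow> real)) set" where
  "fibre_pairs P N K b = {(x,y) \<in> cube b \<times> cube b. (\<forall>i\<in>P. x i = y i) \<and>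
     (\<forall>i. i \<notin> P \<union> N \<longrightarrow> x i = 0) \<and> (\<forall>i. i \<notin> P \<union> K \<longrightarrow> y i = 0)}"

lemma fibre_pairs_subset: "fibre_pairs P N K b \<subseteq> cube b \<times> cube b"
  by (auto simp: fibre_pairs_def)

lemma fibre_pairs_converse: "(fibre_pairs P N K b)\<inverse> = fibre_pairs P K N b"
  by (auto simp: fibre_pairs_def)

lemma continuous_on_coord: "continuous_on UNIV a \<Longrightarrow> continuous_on UNIV (\<lambda>x. a x (i::nat) :: real)"
  by (rule continuous_on_product_then_coordinatewise)

lemma continuous_on_eval: "continuous_on UNIV (\<lambda>x :: nat \<Rightarrow> real. x i)"
  by (rule continuous_on_coord[OF continuous_on_id])

lemma compact_fibre_pairs: "compact (fibre_pairs P N K b)"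
proof -
  let ?F = "\<lambda>i. {p :: (nat \<Rightarrow> real) \<times> (nat \<Rightarrow> real). fst p i = snd p i}"
  have c1: "continuous_on UNIV (\<lambda>p :: (nat \<Rightarrow> real) \<times> (nat \<Rightarrow> real). fst p i)" for i
    by (rule continuous_on_coord[OF continuous_on_fst[OF continuous_on_id]])
  have c2: "continuous_on UNIV (\<lambda>p :: (nat \<Rightarrow> real) \<times> (nat \<Rightarrow> real). snd p i)" for i
    by (rule continuous_on_coord[OF continuous_on_snd[OF continuous_on_id]])
  have "closed {p :: (nat \<Rightarrow> real) \<times> (nat \<Rightarrow> real). fst p i = snd p i}"
    "closed {p :: (nat \<Rightarrow> real) \<times> (nat \<Rightarrow> real). fst p i = 0}"
    "closed {p :: (nat \<Rightarrow> real) \<times> (nat \<Rightarrow> real). snd p i = 0}" for i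
    by (intro closed_Collect_eq c1 c2 continuous_on_const)+
  then have "closed ((\<Inter>i\<in>P. {p :: (nat \<Rightarrow> real) \<times> (nat \<Rightarrow> real). fst p i = snd p i}) \<inter>
      (\<Inter>i\<in>-(P\<union>N). {p. fst p i = 0}) \<inter> (\<Inter>i\<in>-(P\<union>K). {p. snd p i = 0}))" (is "closed ?C")
    by (intro closed_Int closed_INT) auto
  then have "compact ((cube b \<times> cube b) \<inter> ?C)"
    by (intro compact_Int_closed compact_Times compact_cube)
  moreover have "(cube b \<times> cube b) \<inter> ?C = fibre_pairs P N K b"
    by (auto simp: fibre_pairs_def)
  ultimately show ?thesis by simp
qed

lemma continuous_map_unit_cube:
  "continuous_map Y (unit_cube e) f \<longleftrightarrow> f \<in> topspace Y \<rightarrow> extensional {i. enat i < e} \<and>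
     (\<forall>i. enat i < e \<longrightarrow> continuous_map Y euclideanreal (\<lambda>x. f x i) \<and> (\<forall>x\<in>topspace Y. f x i \<in> {0..1}))"
  unfolding unit_cube_def continuous_map_componentwise continuous_map_in_subtopology image_subset_iff
  by (auto simp: image_subset_iff Pi_iff)

lemma unit_cube_eval:
  "enat i < e \<Longrightarrow> continuous_map (unit_cube e) euclideanreal (\<lambda>x. x i)"
  unfolding unit_cube_def
  by (rule continuous_map_into_fulltopology) (rule continuous_map_product_projection, simp)

lemma continuous_map_into_sequences:
  "continuous_map Y euclidean (f :: _ \<Rightarrow> nat \<Rightarrow> real) \<longleftrightarrow> (\<forall>i. continuous_map Y euclideanreal (\<lambda>x. f x i))"
  by (simp add: continuous_map_componentwise_UNIV flip: euclidean_product_topology)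

lemma topspace_unit_cube: "topspace (unit_cube e) = PiE {i. enat i < e} (\<lambda>_. {0..1})"
  by (simp add: unit_cube_def)

text \<open>A chart of the unit cube on the coordinates in \<open>S\<close>; coordinates of the cube beyond
  the cardinality of \<open>S\<close> are filled with zeros, so no monotonicity of the property in the
  dimensions has to be proved.\<close>

lemma unit_cube_chart:
  assumes "finite S" "enat (card S) \<le> e" "c > 0"
  obtains \<rho> \<alpha> where "continuous_map euclidean (unit_cube e) \<rho>"
    "continuous_map (unit_cube e) (euclidean :: (nat \<Rightarrow> real) topology) \<alpha>"
    "\<And>v i. \<alpha> (\<rho> v) i = (if i \<in> S then max (-c) (min c (v i)) else 0)"
    "\<And>v w. (\<forall>i\<in>S. v i = w i) \<Longrightarrow> \<rho> v = \<rho> w"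
proof -
  obtain en where en: "bij_betw en {0..<card S} S"
    using ex_bij_betw_nat_finite[OF assms(1)] by blast
  define ix where "ix = inv_into {0..<card S} en"
  have ix: "ix i < card S" "en (ix i) = i" if "i \<in> S" for i
    using that en bij_betw_inv_into_right[OF en] bij_betw_apply[OF bij_betw_inv_into[OF en]]
    by (auto simp: ix_def)
  have enS: "en j \<in> S" if "j < card S" for j
    using bij_betw_apply[OF en] that by simp
  have ixe: "enat (ix i) < e" if "i \<in> S" for i
    using ix(1)[OF that] assms(2) by (meson enat_ord_simps(2) less_le_trans)
  define \<rho> where "\<rho> v = (\<lambda>j\<in>{j. enat j < e}. if j < card S then (max (-c) (min c (v (en j))) + c) / (2*c) else 0)"
    for v :: "nat \<Rightarrow> real"
  define \<alpha> where "\<alpha> x = (\<lambda>i. if i \<in> S then 2 * c * x (ix i) - c else 0)" for x :: "nat \<Rightarrow> real"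
  have "continuous_map euclidean (unit_cube e) \<rho>"
    unfolding continuous_map_unit_cube
  proof (intro conjI allI impI ballI)
    show "continuous_map euclidean euclideanreal (\<lambda>v. \<rho> v j)" if "enat j < e" for j
      using that assms(3) by (cases "j < card S")
        (auto simp: \<rho>_def intro!: continuous_on_divide continuous_on_add continuous_on_max continuous_on_min
           continuous_on_const continuous_on_eval)
    show "\<rho> v j \<in> {0..1}" if "enat j < e" for v j
      using that assms(3) by (auto simp: \<rho>_def divide_simps max_def min_def)
  qed (auto simp: \<rho>_def)
  moreover have "continuous_map (unit_cube e) euclidean \<alpha>"
    unfolding continuous_map_into_sequences \<alpha>_def
    using ixe by (intro allI) (auto intro!: continuous_map_diff continuous_map_real_mult unit_cube_eval)
  moreover have "\<alpha> (\<rho> v) i = (if i \<in> S then max (-c) (min c (v i)) else 0)" for v i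
    using ix[of i] ixe[of i] assms(3) by (auto simp: \<alpha>_def \<rho>_def field_simps)
  moreover have "\<rho> v = \<rho> w" if "\<forall>i\<in>S. v i = w i" for v w
    using that enS by (auto simp: \<rho>_def restrict_def)
  ultimately show ?thesis by (rule that)
qed

context Metric_space begin

text \<open>A homotopy prescribed on a coordinate subspace extends to all sequences: the map is first
  deformed so that it factors through the subspace near that subspace, and the prescribed homotopy
  is then switched off with growing distance from the subspace.\<close>

lemma extend_homotopy:
  assumes f: "continuous_map euclidean mtopology f" and "finite A" "e > 0" "b \<le> c"
    and \<rho>: "continuous_map euclidean C \<rho>"
    and \<alpha>\<rho>: "\<And>v i. \<alpha> (\<rho> v) i = (if i \<in> A then max (-c) (min c (v i)) else 0)"
    and H: "continuous_map (prod_topology C (top_of_set {0..1::real})) mtopology H"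
      "\<And>p. p \<in> topspace C \<Longrightarrow> H (p, 0) = f (\<alpha> p)"
      "\<And>p t. p \<in> topspace C \<Longrightarrow> t \<in> {0..1} \<Longrightarrow> d (H (p, 0)) (H (p, t)) < e"
  obtains f' where "close_homotopic f f' (2 * e) b" "\<And>x. (\<forall>i. i \<notin> A \<longrightarrow> x i = 0) \<Longrightarrow> f' x = H (\<rho> x, 1)"
proof -
  obtain T \<delta> where "\<delta> > 0" and
    T: "\<forall>x\<in>cube b. \<forall>y\<in>cube b. (\<forall>i<T. \<bar>x i - y i\<bar> \<le> \<delta>) \<longrightarrow> d (f x) (f y) < e"
    by (rule uniform_on_cube[OF f \<open>e > 0\<close>, of b]) (rule that)
  \<comment> \<open>Off \<open>A\<close>, the first \<open>T\<close> coordinates are pulled towards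
    0 by at most \<delta> and the others erased, so that small coordinates become exactly 0.
    Clamping at \<open>c\<close> is invisible on \<open>cube b\<close> since
    \<open>b \<le> c\<close>.\<close>
  define a where "a v = (\<lambda>i. if i \<in> A then max (-c) (min c (v i)) else
      if i < T then v i - max (-\<delta>) (min \<delta> (v i)) else 0)" for v
  have cont_a: "continuous_on UNIV a"
  proof (intro continuous_on_coordinatewise_then_product)
    show "continuous_on UNIV (\<lambda>v. a v i)" for i
      unfolding a_def by (cases "i \<in> A"; cases "i < T")
        (auto intro!: continuous_on_diff continuous_on_max continuous_on_min continuous_on_const continuous_on_eval)
  qed
  have "d (f v) (f (\<lambda>i. (1 - t) * v i + t * a v i)) < e" if v: "v \<in> cube b" and t: "t \<in> {0..1}" for v t
  proof -
    have vb: "\<bar>v i\<bar> \<le> b" for i using cubeD[OF v] .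
    have av: "\<bar>a v i\<bar> \<le> b" for i
      using vb[of i] \<open>b \<le> c\<close> \<open>\<delta> > 0\<close> by (auto simp: a_def)
    have "(\<lambda>i. (1 - t) * v i + t * a v i) \<in> cube b"
      unfolding cube_def
    proof (intro CollectI allI)
      fix i
      have "\<bar>(1 - t) * v i + t * a v i\<bar> \<le> (1 - t) * \<bar>v i\<bar> + t * \<bar>a v i\<bar>"
        using t abs_triangle_ineq[of "(1-t) * v i" "t * a v i"] by (simp add: abs_mult)
      also have "\<dots> \<le> (1 - t) * b + t * b"
        using t vb[of i] av[of i] by (intro add_mono mult_left_mono) auto
      finally show "\<bar>(1 - t) * v i + t * a v i\<bar> \<le> b" by (simp add: algebra_simps)
    qed
    moreover have "\<bar>v i - ((1 - t) * v i + t * a v i)\<bar> \<le> \<delta>" if "i < T" for i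
    proof -
      have "v i - ((1 - t) * v i + t * a v i) = t * (v i - a v i)"
        by (simp add: algebra_simps)
      moreover have "\<bar>v i - a v i\<bar> \<le> \<delta>"
        using that vb[of i] \<open>b \<le> c\<close> \<open>\<delta> > 0\<close> by (auto simp: a_def)
      then have "t * \<bar>v i - a v i\<bar> \<le> 1 * \<delta>"
        using t by (intro mult_mono) auto
      ultimately show ?thesis using t by (simp add: abs_mult)
    qed
    ultimately show ?thesis
      using T[THEN bspec, THEN bspec, OF v, of "\<lambda>i. (1 - t) * v i + t * a v i"] by simp
  qed
  then have first: "close_homotopic f (\<lambda>x. f (a x)) e b"
    by (rule close_homotopic_reparam[OF f cont_a])
  \<comment> \<open>\<open>u\<close> is 1 on the subspace and reaches 0 when the relevant
    coordinates off \<open>A\<close> sum to \<open>\<delta>/2\<close>; as long as it is nonnegative,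
    \<open>a\<close> factors through the chart.\<close>
  define u where "u v = 1 - (2/\<delta>) * (\<Sum>i\<in>{..<T} - A. \<bar>v i\<bar>)" for v :: "nat \<Rightarrow> real"
  have cont_u: "continuous_on UNIV u"
    unfolding u_def by (intro continuous_on_diff continuous_on_mult continuous_on_const continuous_on_sum
        continuous_on_rabs continuous_on_eval)
  have u1: "u v \<le> 1" for v
    using \<open>\<delta> > 0\<close> by (simp add: u_def sum_nonneg)
  have a_flat: "a v = \<alpha> (\<rho> v)" if "0 \<le> u v" for v
  proof
    fix i
    have "\<bar>v i\<bar> \<le> \<delta>" if "i < T" "i \<notin> A"
    proof -
      have "\<bar>v i\<bar> \<le> (\<Sum>i\<in>{..<T} - A. \<bar>v i\<bar>)"
        using that by (intro member_le_sum) auto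
      also have "\<dots> \<le> \<delta>/2"
        using \<open>0 \<le> u v\<close> \<open>\<delta> > 0\<close> by (simp add: u_def field_simps)
      finally show ?thesis using \<open>\<delta> > 0\<close> by simp
    qed
    then show "a v i = \<alpha> (\<rho> v) i"
      by (auto simp: a_def \<alpha>\<rho>)
  qed
  have \<rho>C: "\<rho> v \<in> topspace C" for v
    using continuous_map_image_subset_topspace[OF \<rho>] by auto
  \<comment> \<open>Time is clamped to [0,1] and slowed down by \<open>u\<close>: full speed on the
    subspace, standstill at \<open>u = 0\<close>, where the two pieces of \<open>h\<close>
    meet.\<close>
  let ?s = "\<lambda>p. max 0 (min 1 (snd p)) * max 0 (u (fst p))"
  have s01: "?s p \<in> {0..1}" for p
    using u1[of "fst p"] by (auto intro!: mult_le_one mult_nonneg_nonneg)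
  define h where "h p = (if 0 \<le> u (fst p) then H (\<rho> (fst p), ?s p) else f (a (fst p)))" for p :: "(nat \<Rightarrow> real) \<times> real"
  have cu: "continuous_on UNIV (\<lambda>p :: (nat \<Rightarrow> real) \<times> real. u (fst p))"
    by (rule cont_lift[OF cont_u])
  have cs: "continuous_on UNIV ?s"
    by (intro continuous_on_mult continuous_on_max continuous_on_min continuous_on_const cu continuous_on_snd continuous_on_id)
  have cont_h: "continuous_map euclidean mtopology h"
    unfolding h_def
  proof (intro continuous_map_cases_le continuous_map_from_subtopology)
    have "continuous_map euclidean C (\<lambda>p :: (nat \<Rightarrow> real) \<times> real. \<rho> (fst p))"
      using continuous_map_compose[OF _ \<rho>, of euclidean fst] by (simp add: o_def continuous_on_fst)
    moreover have "continuous_map euclidean (top_of_set {0..1}) ?s"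
      using cs s01 by (auto simp: continuous_map_in_subtopology)
    ultimately have "continuous_map euclidean (prod_topology C (top_of_set {0..1})) (\<lambda>p. (\<rho> (fst p), ?s p))"
      by (simp add: continuous_map_paired)
    from continuous_map_compose[OF this H(1)]
    show "continuous_map euclidean mtopology (\<lambda>p. H (\<rho> (fst p), ?s p))"
      by (simp add: o_def)
    show "continuous_map euclidean mtopology (\<lambda>p :: (nat \<Rightarrow> real) \<times> real. f (a (fst p)))"
      by (rule cont_compose[OF f cont_lift[OF cont_a]])
    show "H (\<rho> (fst p), ?s p) = f (a (fst p))" if "0 = u (fst p)" for p
      using that H(2)[OF \<rho>C] a_flat[of "fst p"] by simp
  qed (use cu in auto)
  have start: "H (\<rho> v, 0) = f (a v)" if "0 \<le> u v" for v
    using that H(2)[OF \<rho>C] a_flat[of v] by simp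
  have "close_homotopic (\<lambda>x. f (a x)) (\<lambda>x. h (x, 1)) e b"
    unfolding close_homotopic_def
  proof (intro exI[of _ h] conjI allI ballI)
    show "h (x, 0) = f (a x)" for x
      using start by (simp add: h_def)
    show "d (f (a x)) (h (x, t)) < e" for x t
    proof (cases "0 \<le> u x")
      case True
      then have "d (H (\<rho> x, 0)) (H (\<rho> x, ?s (x,t))) < e"
        by (intro H(3) \<rho>C s01)
      then show ?thesis using True start[OF True] by (simp add: h_def)
    next
      case False
      then show ?thesis using cont_in_M[OF f] \<open>e > 0\<close> by (simp add: h_def)
    qed
  qed (use cont_h in auto)
  from close_homotopic_trans[OF first this]
  have "close_homotopic f (\<lambda>x. h (x, 1)) (2 * e) b" by simp
  moreover have "h (x, 1) = H (\<rho> x, 1)" if "\<forall>i. i \<notin> A \<longrightarrow> x i = 0" for x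
  proof -
    have "(\<Sum>i\<in>{..<T} - A. \<bar>x i\<bar>) = 0"
      by (intro sum.neutral) (use that in auto)
    then have "u x = 1" by (simp add: u_def)
    then show ?thesis by (simp add: h_def)
  qed
  ultimately show ?thesis by (rule that)
qed

text \<open>Time is reversed because \<open>cover_homotopic\<close> starts at the modified map; two
  points of one ball of radius \<open>r\<close> are less than \<open>2 * r\<close> apart.\<close>

lemma cover_homotopic_mball:
  assumes "cover_homotopic C mtopology ((\<lambda>x. mball x r) ` M) g f"
  obtains H where "continuous_map (prod_topology C (top_of_set {0..1::real})) mtopology H"
      "\<And>p. p \<in> topspace C \<Longrightarrow> H (p, 0) = f p" "\<And>p. p \<in> topspace C \<Longrightarrow> H (p, 1) = g p"
      "\<And>p t. p \<in> topspace C \<Longrightarrow> t \<in> {0..1} \<Longrightarrow> d (H (p, 0)) (H (p, t)) < 2 * r"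
proof -
  obtain h where h: "continuous_map (prod_topology C (top_of_set {0..1::real})) mtopology h"
    "\<forall>p\<in>topspace C. h (p, 0) = g p" "\<forall>p\<in>topspace C. h (p, 1) = f p"
    "\<forall>p\<in>topspace C. \<exists>U\<in>((\<lambda>x. mball x r) ` M). h ` ({p} \<times> {0..1}) \<subseteq> U"
    using assms unfolding cover_homotopic_def by (elim exE conjE) (rule that)
  have "continuous_map (prod_topology C (top_of_set {0..1::real})) (top_of_set {0..1}) (\<lambda>q. 1 - snd q)"
    unfolding continuous_map_in_subtopology
    by (auto intro!: continuous_map_diff continuous_map_snd_of continuous_map_into_fulltopology[OF continuous_map_snd])
  then have "continuous_map (prod_topology C (top_of_set {0..1::real})) (prod_topology C (top_of_set {0..1})) (\<lambda>q. (fst q, 1 - snd q))"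
    by (simp add: continuous_map_paired continuous_map_fst)
  from continuous_map_compose[OF this h(1)]
  have "continuous_map (prod_topology C (top_of_set {0..1::real})) mtopology (\<lambda>q. h (fst q, 1 - snd q))"
    by (simp add: o_def)
  moreover have "d (h (p, 1 - 0)) (h (p, 1 - t)) < 2 * r" if pt: "p \<in> topspace C" "t \<in> {0..1}" for p t
  proof -
    obtain x where x: "x \<in> M" "h ` ({p} \<times> {0..1}) \<subseteq> mball x r"
      using bspec[OF h(4) pt(1)] by (elim bexE imageE) (simp only:)
    have "h (p, 1 - 0) \<in> mball x r" "h (p, 1 - t) \<in> mball x r"
      using x(2) pt(2) by (auto simp: image_subset_iff)
    then show ?thesis
      using triangle'[of "h (p, 1 - 0)" x "h (p, 1 - t)"] by (auto simp: commute)
  qed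
  ultimately show ?thesis
    using h(2,3) by (intro that[of "\<lambda>q. h (fst q, 1 - snd q)"]) auto
qed

text \<open>The charts pull both maps back to cubes, where the property applies, and the homotopies
  extend to all sequences. If \<open>x\<close> and \<open>y\<close> agree on \<open>P\<close>, then
  \<open>\<rho>P x = \<rho>P y\<close>, so fibrewise disjointness separates their images.\<close>

lemma can_separate_of_DD:
  assumes DD: "DD_property m n k mtopology"
    and fin: "finite P" "finite N" "finite K" "P \<inter> N = {}" "P \<inter> K = {}"
    and card: "enat (card P) \<le> m" "enat (card N) \<le> n" "enat (card K) \<le> k"
  shows "can_separate (fibre_pairs P N K b0)"
  unfolding can_separate_def
proof (intro allI impI)
  fix f g :: "(nat \<Rightarrow> real) \<Rightarrow> 'a" and e b :: real
  assume f: "continuous_map euclidean mtopology f" and g: "continuous_map euclidean mtopology g" and "e > 0"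
  define c where "c = max 1 (max b b0)"
  have "c > 0" "b \<le> c" by (auto simp: c_def)
  obtain \<rho>P \<alpha>P where P: "continuous_map euclidean (unit_cube m) \<rho>P"
    "continuous_map (unit_cube m) (euclidean :: (nat \<Rightarrow> real) topology) \<alpha>P"
    "\<And>v i. \<alpha>P (\<rho>P v) i = (if i \<in> P then max (-c) (min c (v i)) else 0)"
    "\<And>v w. (\<forall>i\<in>P. v i = w i) \<Longrightarrow> \<rho>P v = \<rho>P w"
    using unit_cube_chart[OF fin(1) card(1) \<open>c > 0\<close>] by metis
  obtain \<rho>N \<alpha>N where N: "continuous_map euclidean (unit_cube n) \<rho>N"
    "continuous_map (unit_cube n) (euclidean :: (nat \<Rightarrow> real) topology) \<alpha>N"
    "\<And>v i. \<alpha>N (\<rho>N v) i = (if i \<in> N then max (-c) (min c (v i)) else 0)"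
    using unit_cube_chart[OF fin(2) card(2) \<open>c > 0\<close>] by metis
  obtain \<rho>K \<alpha>K where K: "continuous_map euclidean (unit_cube k) \<rho>K"
    "continuous_map (unit_cube k) (euclidean :: (nat \<Rightarrow> real) topology) \<alpha>K"
    "\<And>v i. \<alpha>K (\<rho>K v) i = (if i \<in> K then max (-c) (min c (v i)) else 0)"
    using unit_cube_chart[OF fin(3) card(3) \<open>c > 0\<close>] by metis
  define \<rho>f where "\<rho>f v = (\<rho>P v, \<rho>N v)" for v
  define \<rho>g where "\<rho>g v = (\<rho>P v, \<rho>K v)" for v
  define \<alpha>f where "\<alpha>f p = (\<lambda>i. \<alpha>P (fst p) i + \<alpha>N (snd p) i)" for p
  define \<alpha>g where "\<alpha>g p = (\<lambda>i. \<alpha>P (fst p) i + \<alpha>K (snd p) i)" for p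
  let ?Cf = "prod_topology (unit_cube m) (unit_cube n)"
  let ?Cg = "prod_topology (unit_cube m) (unit_cube k)"
  have cr: "continuous_map euclidean ?Cf \<rho>f" "continuous_map euclidean ?Cg \<rho>g"
    unfolding \<rho>f_def \<rho>g_def using P N K by (simp_all add: continuous_map_paired)
  have co: "continuous_map (prod_topology Y Z) euclideanreal (\<lambda>p. \<alpha> (fst p) i)"
    if "continuous_map Y (euclidean :: (nat \<Rightarrow> real) topology) \<alpha>" for Y :: "(nat \<Rightarrow> real) topology" and Z :: "(nat \<Rightarrow> real) topology" and \<alpha> i
    using that continuous_map_compose[OF continuous_map_fst, of Y euclideanreal "\<lambda>x. \<alpha> x i" Z]
    by (simp add: o_def continuous_map_into_sequences)
  have co2: "continuous_map (prod_topology Y Z) euclideanreal (\<lambda>p. \<alpha> (snd p) i)"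
    if "continuous_map Z (euclidean :: (nat \<Rightarrow> real) topology) \<alpha>" for Y :: "(nat \<Rightarrow> real) topology" and Z :: "(nat \<Rightarrow> real) topology" and \<alpha> i
    using that continuous_map_compose[OF continuous_map_snd, of Z euclideanreal "\<lambda>x. \<alpha> x i" Y]
    by (simp add: o_def continuous_map_into_sequences)
  have ca: "continuous_map ?Cf euclidean \<alpha>f" "continuous_map ?Cg euclidean \<alpha>g"
    unfolding \<alpha>f_def \<alpha>g_def continuous_map_into_sequences
    using P(2) N(2) K(2) by (auto intro!: continuous_map_add co co2)
  have af: "\<alpha>f (\<rho>f v) i = (if i \<in> P \<union> N then max (-c) (min c (v i)) else 0)" for v i
    using fin(4) by (auto simp: \<alpha>f_def \<rho>f_def P(3) N(3))
  have ag: "\<alpha>g (\<rho>g v) i = (if i \<in> P \<union> K then max (-c) (min c (v i)) else 0)" for v i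
    using fin(5) by (auto simp: \<alpha>g_def \<rho>g_def P(3) K(3))
  \<comment> \<open>A track inside a ball of radius \<open>e/4\<close> moves by less than
    \<open>e/2\<close>, and the extension to all sequences doubles this bound.\<close>
  define \<U> where "\<U> = (\<lambda>x. mball x (e/4)) ` M"
  have "open_cover_of mtopology \<U>"
    unfolding open_cover_of_def \<U>_def using \<open>e > 0\<close> by auto
  moreover have "continuous_map ?Cf mtopology (\<lambda>p. f (\<alpha>f p))" "continuous_map ?Cg mtopology (\<lambda>p. g (\<alpha>g p))"
    using continuous_map_compose[OF ca(1) f] continuous_map_compose[OF ca(2) g] by (simp_all add: o_def)
  ultimately obtain f1 g1 where
    f1: "cover_homotopic ?Cf mtopology \<U> f1 (\<lambda>p. f (\<alpha>f p))" and
    g1: "cover_homotopic ?Cg mtopology \<U> g1 (\<lambda>p. g (\<alpha>g p))" and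
    dis: "\<forall>z\<in>topspace (unit_cube m). f1 ` ({z} \<times> topspace (unit_cube n)) \<inter> g1 ` ({z} \<times> topspace (unit_cube k)) = {}"
    using DD unfolding DD_property_def by (elim allE impE exE conjE) auto
  obtain F where F: "continuous_map (prod_topology ?Cf (top_of_set {0..1::real})) mtopology F"
      "\<And>p. p \<in> topspace ?Cf \<Longrightarrow> F (p, 0) = f (\<alpha>f p)" "\<And>p. p \<in> topspace ?Cf \<Longrightarrow> F (p, 1) = f1 p"
      "\<And>p t. p \<in> topspace ?Cf \<Longrightarrow> t \<in> {0..1} \<Longrightarrow> d (F (p, 0)) (F (p, t)) < 2 * (e/4)"
    using cover_homotopic_mball[OF f1[unfolded \<U>_def]] by metis
  obtain G where G: "continuous_map (prod_topology ?Cg (top_of_set {0..1::real})) mtopology G"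
      "\<And>p. p \<in> topspace ?Cg \<Longrightarrow> G (p, 0) = g (\<alpha>g p)" "\<And>p. p \<in> topspace ?Cg \<Longrightarrow> G (p, 1) = g1 p"
      "\<And>p t. p \<in> topspace ?Cg \<Longrightarrow> t \<in> {0..1} \<Longrightarrow> d (G (p, 0)) (G (p, t)) < 2 * (e/4)"
    using cover_homotopic_mball[OF g1[unfolded \<U>_def]] by metis
  obtain f' where f': "close_homotopic f f' (2 * (2 * (e/4))) b" "\<And>x. (\<forall>i. i \<notin> P \<union> N \<longrightarrow> x i = 0) \<Longrightarrow> f' x = F (\<rho>f x, 1)"
    using extend_homotopy[OF f _ _ \<open>b \<le> c\<close> cr(1), of "P \<union> N" "2 * (e/4)" \<alpha>f F] fin \<open>e > 0\<close> af F by auto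
  obtain g' where g': "close_homotopic g g' (2 * (2 * (e/4))) b" "\<And>x. (\<forall>i. i \<notin> P \<union> K \<longrightarrow> x i = 0) \<Longrightarrow> g' x = G (\<rho>g x, 1)"
    using extend_homotopy[OF g _ _ \<open>b \<le> c\<close> cr(2), of "P \<union> K" "2 * (e/4)" \<alpha>g G] fin \<open>e > 0\<close> ag G by auto
  have "f' x \<noteq> g' y" if "(x, y) \<in> fibre_pairs P N K b0" for x y
  proof -
    have inC: "\<rho>P x \<in> topspace (unit_cube m)" "\<rho>N x \<in> topspace (unit_cube n)" "\<rho>K y \<in> topspace (unit_cube k)"
      using continuous_map_image_subset_topspace[OF P(1)] continuous_map_image_subset_topspace[OF N(1)]
        continuous_map_image_subset_topspace[OF K(1)] by auto
    have "f' x = F (\<rho>f x, 1)" "g' y = G (\<rho>g y, 1)"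
      using that f'(2)[of x] g'(2)[of y] by (auto simp: fibre_pairs_def)
    moreover have "\<rho>P x = \<rho>P y"
      using that by (intro P(4)) (auto simp: fibre_pairs_def)
    ultimately have "f' x = f1 (\<rho>P x, \<rho>N x)" "g' y = g1 (\<rho>P x, \<rho>K y)"
      using inC F(3)[of "(\<rho>P x, \<rho>N x)"] G(3)[of "(\<rho>P x, \<rho>K y)"] by (auto simp: \<rho>f_def \<rho>g_def)
    then show ?thesis
      using dis inC by fastforce
  qed
  with f'(1) g'(1) show "\<exists>f' g'. close_homotopic f f' e b \<and> close_homotopic g g' e b \<and>
      (\<forall>(x,y)\<in>fibre_pairs P N K b0. f' x \<noteq> g' y)"
    by (intro exI[of _ f'] exI[of _ g']) auto
qed

end

section \<open>From separation to the disjoint disks property\<close>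

lemma card_residue_class_le:
  assumes "finite S" "S \<subseteq> {j. j mod 3 = s \<and> enat (j div 3) < e}"
  shows "enat (card S) \<le> e"
proof (cases e)
  case (enat q)
  have "inj_on (\<lambda>j. j div 3) S"
    using assms(2) by (intro inj_onI) (metis (mono_tags, lifting) div_mult_mod_eq mem_Collect_eq subsetD)
  then have "card S \<le> card {..<q}"
    using assms(2) enat by (intro card_inj_on_le) auto
  then show ?thesis by (simp add: enat)
qed simp

text \<open>The coordinates of the parameter cube and of the two fibre cubes are placed at the
  residue classes modulo 3, so that all three may be infinite.\<close>

definition spread :: "nat \<Rightarrow> enat \<Rightarrow> (nat \<Rightarrow> real) \<Rightarrow> nat \<Rightarrow> real" where
  "spread s e x = (\<lambda>j. if j mod 3 = s \<and> enat (j div 3) < e then x (j div 3) else 0)"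

definition gather :: "nat \<Rightarrow> enat \<Rightarrow> (nat \<Rightarrow> real) \<Rightarrow> nat \<Rightarrow> real" where
  "gather s e v = (\<lambda>i\<in>{i. enat i < e}. max 0 (min 1 (v (3 * i + s))))"

lemma continuous_map_gather: "continuous_map euclidean (unit_cube e) (gather s e)"
  unfolding continuous_map_unit_cube
  by (auto simp: gather_def intro!: continuous_on_max continuous_on_min continuous_on_const continuous_on_eval)

lemma continuous_map_spread: "continuous_map (unit_cube e) euclideanreal (\<lambda>x. spread s e x j)"
  by (cases "j mod 3 = s \<and> enat (j div 3) < e") (auto simp: spread_def unit_cube_eval)

lemma spread_range: "x \<in> topspace (unit_cube e) \<Longrightarrow> spread s e x j \<in> {0..1}"
  by (auto simp: spread_def topspace_unit_cube PiE_iff)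

lemma spread_gather:
  assumes "x \<in> topspace (unit_cube e)" "s < 3" "\<And>j. j mod 3 = s \<Longrightarrow> y j = spread s e x j"
  shows "gather s e y = x"
proof
  fix i
  have "spread s e x (3 * i + s) = x i" if "enat i < e"
    using that assms(2) by (simp add: spread_def)
  then show "gather s e y i = x i"
    using assms(1) assms(3)[of "3 * i + s"] assms(2)
    by (auto simp: gather_def topspace_unit_cube PiE_iff extensional_def)
qed

context Metric_space begin

lemma cover_homotopic_of_close:
  assumes F: "close_homotopic F F' e b" and \<alpha>: "continuous_map C euclidean \<alpha>"
    and b: "\<And>p. p \<in> topspace C \<Longrightarrow> \<alpha> p \<in> cube b"
    and \<U>: "\<forall>x\<in>cube b. \<exists>U\<in>\<U>. mball (F x) e \<subseteq> U"
  shows "cover_homotopic C mtopology \<U> (\<lambda>p. F' (\<alpha> p)) (\<lambda>p. F (\<alpha> p))"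
proof -
  obtain h where h: "continuous_map (euclidean :: ((nat \<Rightarrow> real) \<times> real) topology) mtopology h"
    "\<forall>x. h (x, 0) = F x" "\<forall>x. h (x, 1) = F' x" "\<forall>x\<in>cube b. \<forall>t\<in>{0..1}. d (F x) (h (x, t)) < e"
    using F unfolding close_homotopic_def by (elim exE conjE) (rule that)
  have "continuous_map (prod_topology C (top_of_set {0..1::real})) euclideanreal (\<lambda>q. 1 - snd q)"
    by (auto intro!: continuous_map_diff continuous_map_into_fulltopology[OF continuous_map_snd])
  moreover have "continuous_map (prod_topology C (top_of_set {0..1::real})) euclidean (\<lambda>q. \<alpha> (fst q))"
    using continuous_map_compose[OF continuous_map_fst \<alpha>] by (simp add: o_def)
  ultimately have "continuous_map (prod_topology C (top_of_set {0..1::real})) (prod_topology euclidean euclidean) (\<lambda>q. (\<alpha> (fst q), 1 - snd q))"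
    by (simp only: continuous_map_paired)
  from continuous_map_compose[OF this, of mtopology h] h(1)
  have "continuous_map (prod_topology C (top_of_set {0..1::real})) mtopology (\<lambda>q. h (\<alpha> (fst q), 1 - snd q))"
    by (simp add: o_def)
  moreover have "\<exists>U\<in>\<U>. (\<lambda>q. h (\<alpha> (fst q), 1 - snd q)) ` ({p} \<times> {0..1}) \<subseteq> U" if p: "p \<in> topspace C" for p
  proof -
    obtain U where "U \<in> \<U>" "mball (F (\<alpha> p)) e \<subseteq> U"
      using \<U> b[OF p] by auto
    moreover have "h (\<alpha> p, 1 - t) \<in> mball (F (\<alpha> p)) e" if "t \<in> {0..1}" for t
      using h(4)[THEN bspec, THEN bspec, OF b[OF \<open>p \<in> topspace C\<close>], of "1 - t"] that
        cont_in_M[OF h(1)] cont_in_M[OF close_homotopic_cont(1)[OF F]] by simp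
    ultimately show ?thesis by (intro bexI[of _ U]) auto
  qed
  ultimately show ?thesis
    unfolding cover_homotopic_def
    by (intro exI[of _ "\<lambda>q. h (\<alpha> (fst q), 1 - snd q)"]) (simp add: h(2,3))
qed

lemma lebesgue_on_cube:
  assumes "continuous_map euclidean mtopology F" "open_cover_of mtopology \<U>"
  obtains e where "e > 0" "\<forall>x\<in>cube b. \<exists>U\<in>\<U>. mball (F x) e \<subseteq> U"
proof -
  have "compactin mtopology (F ` cube b)"
    using image_compactin[OF _ assms(1)] compact_cube[of b] by (simp add: compactin_euclidean_iff)
  moreover have "F ` cube b \<subseteq> \<Union>\<U>"
    using assms(2) cont_in_M[OF assms(1)] by (auto simp: open_cover_of_def)
  ultimately have "\<exists>e>0. \<forall>x\<in>F ` cube b. \<exists>U\<in>\<U>. mball x e \<subseteq> U"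
    using assms(2) by (intro lebesgue_number) (auto simp: open_cover_of_def)
  then show ?thesis using that by auto
qed

text \<open>Every level beyond \<open>T\<close> works too, so one common level can serve two
  maps.\<close>

lemma close_homotopic_truncate:
  assumes F: "continuous_map euclidean mtopology F" and "e > 0" "b \<ge> 0"
  obtains T where "\<And>T'. T \<le> T' \<Longrightarrow> close_homotopic F (\<lambda>x. F (\<lambda>i. if i < T' then x i else 0)) e b"
proof -
  obtain T \<delta> where "\<delta> > 0" and
    T: "\<forall>x\<in>cube b. \<forall>y\<in>cube b. (\<forall>i<T. \<bar>x i - y i\<bar> \<le> \<delta>) \<longrightarrow> d (F x) (F y) < e"
    by (rule uniform_on_cube[OF F \<open>e > 0\<close>, of b]) (rule that)
  have "close_homotopic F (\<lambda>x. F (\<lambda>i. if i < T' then x i else 0)) e b" if "T \<le> T'" for T'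
  proof (rule close_homotopic_reparam[OF F])
    show "continuous_on UNIV (\<lambda>x i. if i < T' then x i else 0 :: real)"
    proof (rule continuous_on_coordinatewise_then_product)
      show "continuous_on UNIV (\<lambda>x. if i < T' then x i else 0 :: real)" for i
        by (cases "i < T'") (auto intro: continuous_on_eval)
    qed
    fix x :: "nat \<Rightarrow> real" and t :: real
    assume x: "x \<in> cube b" and t: "t \<in> {0..1}"
    define y where "y = (\<lambda>i. (1 - t) * x i + t * (if i < T' then x i else 0))"
    have y: "y i = x i \<or> y i = (1 - t) * x i" for i
      by (auto simp: y_def algebra_simps)
    have "\<bar>(1 - t) * x i\<bar> \<le> 1 * b" for i
      using cubeD[OF x, of i] t \<open>b \<ge> 0\<close> unfolding abs_mult by (intro mult_mono) auto
    then have "y \<in> cube b"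
      unfolding cube_def using cubeD[OF x] y by (intro CollectI allI) (metis mult_1)
    moreover have "\<forall>i<T. \<bar>x i - y i\<bar> \<le> \<delta>"
      using \<open>T \<le> T'\<close> \<open>\<delta> > 0\<close> by (auto simp: y_def algebra_simps)
    ultimately have "d (F x) (F y) < e"
      using T[THEN bspec, THEN bspec, OF x, of y] by simp
    then show "d (F x) (F (\<lambda>i. (1 - t) * x i + t * (if i < T' then x i else 0))) < e"
      by (simp only: y_def)
  qed
  then show ?thesis by (rule that)
qed

text \<open>Clamping by \<open>gather\<close> inverts the embedding of the cubes, which extends
  \<open>f\<close> and \<open>g\<close> to all sequences. Truncation then leaves finitely many
  coordinates of each kind, so finite \<open>P\<close>, \<open>N\<close>, \<open>K\<close> suffice
  even for infinite dimensions.\<close>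

lemma DD_of_can_separate:
  assumes sep: "\<And>P N K. finite P \<Longrightarrow> finite N \<Longrightarrow> finite K \<Longrightarrow> P \<inter> N = {} \<Longrightarrow> P \<inter> K = {} \<Longrightarrow>
     enat (card P) \<le> m \<Longrightarrow> enat (card N) \<le> n \<Longrightarrow> enat (card K) \<le> k \<Longrightarrow> can_separate (fibre_pairs P N K 1)"
  shows "DD_property m n k mtopology"
  unfolding DD_property_def
proof (intro allI impI)
  let ?Cf = "prod_topology (unit_cube m) (unit_cube n)"
  let ?Cg = "prod_topology (unit_cube m) (unit_cube k)"
  fix \<U> f g
  assume \<U>: "open_cover_of mtopology \<U>" and f: "continuous_map ?Cf mtopology f" and g: "continuous_map ?Cg mtopology g"
  define \<alpha> where "\<alpha> s e p = (\<lambda>j. spread 0 m (fst p) j + spread s e (snd p) j)" for s e p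
  define \<rho> where "\<rho> s e v = (gather 0 m v, gather s e v)" for s e v
  have \<alpha>\<rho>: "\<rho> s e (\<alpha> s e p) = p" if "p \<in> topspace (prod_topology (unit_cube m) (unit_cube e))" "s \<in> {1,2}" for s e p
    unfolding \<rho>_def using that
    by (cases p) (auto simp: \<alpha>_def spread_def intro!: spread_gather)
  have cont_\<alpha>: "continuous_map (prod_topology (unit_cube m) (unit_cube e)) euclidean (\<alpha> s e)" for s e
    unfolding continuous_map_into_sequences \<alpha>_def
  proof (intro allI continuous_map_add)
    show "continuous_map (prod_topology (unit_cube m) (unit_cube e)) euclideanreal (\<lambda>p. spread 0 m (fst p) i)" for i
      using continuous_map_compose[OF continuous_map_fst continuous_map_spread, of m "unit_cube e" 0 i]
      by (simp add: o_def)
    show "continuous_map (prod_topology (unit_cube m) (unit_cube e)) euclideanreal (\<lambda>p. spread s e (snd p) i)" for i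
      using continuous_map_compose[OF continuous_map_snd continuous_map_spread, of "unit_cube m" e s i]
      by (simp add: o_def)
  qed
  have \<alpha>_cube: "\<alpha> s e p \<in> cube 1" if "p \<in> topspace (prod_topology (unit_cube m) (unit_cube e))" "s \<in> {1,2}" for s e p
    unfolding cube_def
  proof (intro CollectI allI)
    fix j
    have "spread 0 m (fst p) j \<in> {0..1}" "spread s e (snd p) j \<in> {0..1}"
      using that by (auto intro!: spread_range simp del: atLeastAtMost_iff)
    moreover have "spread 0 m (fst p) j = 0 \<or> spread s e (snd p) j = 0"
      using that(2) by (auto simp: spread_def)
    ultimately show "\<bar>\<alpha> s e p j\<bar> \<le> 1" by (auto simp: \<alpha>_def)
  qed
  have cont_\<rho>: "continuous_map euclidean (prod_topology (unit_cube m) (unit_cube e)) (\<rho> s e)" for s e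
    unfolding \<rho>_def by (simp add: continuous_map_paired continuous_map_gather)
  define F where "F = f \<circ> \<rho> 1 n"
  define G where "G = g \<circ> \<rho> 2 k"
  have F: "continuous_map euclidean mtopology F" and G: "continuous_map euclidean mtopology G"
    unfolding F_def G_def by (rule continuous_map_compose[OF cont_\<rho> f] continuous_map_compose[OF cont_\<rho> g])+
  have F\<alpha>: "F (\<alpha> 1 n p) = f p" if "p \<in> topspace ?Cf" for p
    using \<alpha>\<rho>[OF that] by (simp add: F_def)
  have G\<alpha>: "G (\<alpha> 2 k p) = g p" if "p \<in> topspace ?Cg" for p
    using \<alpha>\<rho>[OF that] by (simp add: G_def)
  obtain eF where eF: "eF > 0" "\<forall>x\<in>cube 1. \<exists>U\<in>\<U>. mball (F x) eF \<subseteq> U"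
    by (rule lebesgue_on_cube[OF F \<U>, of 1]) (rule that)
  obtain eG where eG: "eG > 0" "\<forall>x\<in>cube 1. \<exists>U\<in>\<U>. mball (G x) eG \<subseteq> U"
    by (rule lebesgue_on_cube[OF G \<U>, of 1]) (rule that)
  define e where "e = min eF eG"
  have "e/2 > 0" using eF eG by (simp add: e_def)
  obtain TF where TF: "\<And>T'. TF \<le> T' \<Longrightarrow> close_homotopic F (\<lambda>x. F (\<lambda>i. if i < T' then x i else 0)) (e/2) 1"
    by (rule close_homotopic_truncate[OF F \<open>e/2 > 0\<close>, of 1]) (use that in auto)
  obtain TG where TG: "\<And>T'. TG \<le> T' \<Longrightarrow> close_homotopic G (\<lambda>x. G (\<lambda>i. if i < T' then x i else 0)) (e/2) 1"
    by (rule close_homotopic_truncate[OF G \<open>e/2 > 0\<close>, of 1]) (use that in auto)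
  define T where "T = max TF TG"
  define \<tau> where "\<tau> x = (\<lambda>i. if i < T then x i else 0)" for x :: "nat \<Rightarrow> real"
  have \<tau>F: "close_homotopic F (\<lambda>x. F (\<tau> x)) (e/2) 1" and \<tau>G: "close_homotopic G (\<lambda>x. G (\<tau> x)) (e/2) 1"
    unfolding \<tau>_def using TF[of T] TG[of T] by (auto simp: T_def)
  have cont_\<tau>: "continuous_on UNIV \<tau>"
  proof (rule continuous_on_coordinatewise_then_product)
    show "continuous_on UNIV (\<lambda>x. \<tau> x i)" for i
      by (cases "i < T") (auto simp: \<tau>_def intro: continuous_on_eval)
  qed
  have \<tau>_cube: "\<tau> x \<in> cube 1" if "x \<in> cube 1" for x
    using cubeD[OF that] by (auto simp: \<tau>_def cube_def)
  define S where "S s e = {j. j < T \<and> j mod 3 = s \<and> enat (j div 3) < e}" for s e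
  have S: "finite (S s e)" "enat (card (S s e)) \<le> e" for s e
  proof -
    show fin: "finite (S s e)"
      by (rule finite_subset[of _ "{..<T}"]) (auto simp: S_def)
    show "enat (card (S s e)) \<le> e"
      by (rule card_residue_class_le[OF fin, of s]) (auto simp: S_def)
  qed
  have "can_separate (fibre_pairs (S 0 m) (S 1 n) (S 2 k) 1)"
    by (intro sep S) (auto simp: S_def)
  then obtain F1 G1 where F1: "close_homotopic F F1 (e/2) 1" and G1: "close_homotopic G G1 (e/2) 1"
    and dis: "\<And>x y. (x, y) \<in> fibre_pairs (S 0 m) (S 1 n) (S 2 k) 1 \<Longrightarrow> F1 x \<noteq> G1 y"
    using can_separateD[OF _ F G \<open>e/2 > 0\<close>] by metis
  have "close_homotopic F (\<lambda>x. F1 (\<tau> x)) (e/2 + e/2) 1"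
    by (rule close_homotopic_trans[OF \<tau>F close_homotopic_precompose[OF F1 cont_\<tau> \<tau>_cube]])
  then have 1: "close_homotopic F (\<lambda>x. F1 (\<tau> x)) eF 1"
    by (rule close_homotopic_mono) (auto simp: e_def)
  have "close_homotopic G (\<lambda>x. G1 (\<tau> x)) (e/2 + e/2) 1"
    by (rule close_homotopic_trans[OF \<tau>G close_homotopic_precompose[OF G1 cont_\<tau> \<tau>_cube]])
  then have 2: "close_homotopic G (\<lambda>x. G1 (\<tau> x)) eG 1"
    by (rule close_homotopic_mono) (auto simp: e_def)
  define f' where "f' p = F1 (\<tau> (\<alpha> 1 n p))" for p
  define g' where "g' p = G1 (\<tau> (\<alpha> 2 k p))" for p
  have "cover_homotopic ?Cf mtopology \<U> f' (\<lambda>p. F (\<alpha> 1 n p))"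
    unfolding f'_def by (rule cover_homotopic_of_close[OF 1 cont_\<alpha> _ eF(2)]) (simp add: \<alpha>_cube)
  then have hf: "cover_homotopic ?Cf mtopology \<U> f' f"
    unfolding cover_homotopic_def using F\<alpha> by simp
  have "cover_homotopic ?Cg mtopology \<U> g' (\<lambda>p. G (\<alpha> 2 k p))"
    unfolding g'_def by (rule cover_homotopic_of_close[OF 2 cont_\<alpha> _ eG(2)]) (simp add: \<alpha>_cube)
  then have hg: "cover_homotopic ?Cg mtopology \<U> g' g"
    unfolding cover_homotopic_def using G\<alpha> by simp
  have cf: "continuous_map ?Cf mtopology f'" and cg: "continuous_map ?Cg mtopology g'"
    using continuous_map_compose[OF cont_\<alpha> close_homotopic_cont(2)[OF 1]]
      continuous_map_compose[OF cont_\<alpha> close_homotopic_cont(2)[OF 2]] by (simp_all add: f'_def[abs_def] g'_def[abs_def] o_def)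
  have "f' (z, s) \<noteq> g' (z, t)" if "z \<in> topspace (unit_cube m)" "s \<in> topspace (unit_cube n)" "t \<in> topspace (unit_cube k)" for z s t
    unfolding f'_def g'_def
  proof (rule dis)
    have "\<tau> (\<alpha> 1 n (z, s)) \<in> cube 1" "\<tau> (\<alpha> 2 k (z, t)) \<in> cube 1"
      using that by (auto intro!: \<tau>_cube \<alpha>_cube)
    then show "(\<tau> (\<alpha> 1 n (z, s)), \<tau> (\<alpha> 2 k (z, t))) \<in> fibre_pairs (S 0 m) (S 1 n) (S 2 k) 1"
      by (auto simp: fibre_pairs_def \<tau>_def \<alpha>_def S_def spread_def)
  qed
  then have "\<forall>z\<in>topspace (unit_cube m). f' ` ({z} \<times> topspace (unit_cube n)) \<inter> g' ` ({z} \<times> topspace (unit_cube k)) = {}"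
    by auto
  then show "\<exists>f' g'. continuous_map ?Cf mtopology f' \<and> continuous_map ?Cg mtopology g' \<and>
     cover_homotopic ?Cf mtopology \<U> f' f \<and> cover_homotopic ?Cg mtopology \<U> g' g \<and>
     (\<forall>z\<in>topspace (unit_cube m). f' ` ({z} \<times> topspace (unit_cube n)) \<inter> g' ` ({z} \<times> topspace (unit_cube k)) = {})"
    using hf hg cf cg by blast
qed

end

section \<open>Geometry of the lattice join\<close>

lemma continuous_on_Max:
  fixes f :: "'i \<Rightarrow> 'x::topological_space \<Rightarrow> real"
  assumes "finite I" "I \<noteq> {}" "\<And>i. i \<in> I \<Longrightarrow> continuous_on S (f i)"
  shows "continuous_on S (\<lambda>x. MAX i\<in>I. f i x)"
  using assms
proof (induction I rule: finite_ne_induct)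
  case (insert i I)
  then have "continuous_on S (\<lambda>x. max (f i x) (MAX i\<in>I. f i x))"
    by (intro continuous_on_max) auto
  then show ?case using insert by simp
qed simp

lemma continuous_on_Min:
  fixes f :: "'i \<Rightarrow> 'x::topological_space \<Rightarrow> real"
  assumes "finite I" "I \<noteq> {}" "\<And>i. i \<in> I \<Longrightarrow> continuous_on S (f i)"
  shows "continuous_on S (\<lambda>x. MIN i\<in>I. f i x)"
  using assms
proof (induction I rule: finite_ne_induct)
  case (insert i I)
  then have "continuous_on S (\<lambda>x. min (f i x) (MIN i\<in>I. f i x))"
    by (intro continuous_on_min) auto
  then show ?case using insert by simp
qed simp

section \<open>Flats of the two skeleta and cones between them\<close>

definition translate :: "nat set \<Rightarrow> (nat \<Rightarrow> real) \<Rightarrow> (nat \<Rightarrow> real) \<Rightarrow> nat \<Rightarrow> real" where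
  "translate J l x = (\<lambda>i. if i \<in> J then x i + l i else x i)"

text \<open>Cone coordinates: the largest distance of the \<open>J\<close>-coordinates from
  \<open>l\<close> is the height above the flat, and the remaining parameters contract towards
  \<open>m\<close> by 1 minus that height.\<close>

definition squeeze :: "real \<Rightarrow> nat set \<Rightarrow> nat set \<Rightarrow> (nat \<Rightarrow> real) \<Rightarrow> (nat \<Rightarrow> real) \<Rightarrow> (nat \<Rightarrow> real) \<Rightarrow> nat \<Rightarrow> real" where
  "squeeze \<eta> P J l m y =
     (\<lambda>i. if i \<in> P - J then m i + (y i - m i) * (1 - min (MAX j\<in>J. \<bar>y j - l j\<bar>) (1 - \<eta>)) else y i)"

text \<open>When \<open>J\<close> and \<open>J'\<close> avoid the fibre coordinates,
  \<open>x\<close> has its \<open>J\<close>-coordinates fixed at \<open>l\<close> and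
  \<open>y\<close> its \<open>J'\<close>-coordinates at \<open>m\<close>. Nothing links
  \<open>x\<close> to \<open>y\<close>, so this is a case for the 0-dimensional property, the free
  parameters counting as fibre dimensions.\<close>

definition flat_pairs :: "nat set \<Rightarrow> nat set \<Rightarrow> nat set \<Rightarrow> real \<Rightarrow> nat set \<Rightarrow> (nat \<Rightarrow> real) \<Rightarrow> nat set \<Rightarrow> (nat \<Rightarrow> real) \<Rightarrow>
    ((nat \<Rightarrow> real) \<times> (nat \<Rightarrow> real)) set" where
  "flat_pairs P N K b J l J' m = (\<lambda>(x,y). (translate J l x, translate J' m y)) ` fibre_pairs {} ((P - J) \<union> N) ((P - J') \<union> K) b"

text \<open>The second map sees the cone_pairs from a flat towards the dual skeleton. Its fibres shrink to points
  at the dual skeleton, so it is cut off at distance \<open>\<eta>\<close> from there; this makes \<open>squeeze\<close> a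
  homeomorphism of the whole space.\<close>

definition cone_pairs :: "real \<Rightarrow> nat set \<Rightarrow> nat set \<Rightarrow> nat set \<Rightarrow> real \<Rightarrow> nat set \<Rightarrow> (nat \<Rightarrow> real) \<Rightarrow> (nat \<Rightarrow> real) \<Rightarrow>
    ((nat \<Rightarrow> real) \<times> (nat \<Rightarrow> real)) set" where
  "cone_pairs \<eta> P N K b J l m = (\<lambda>(x,y). (translate J l x, squeeze \<eta> P J l m y)) ` fibre_pairs (P - J) N (K \<union> J) b"

lemma continuous_translate: "continuous_on UNIV (translate J l)"
proof (rule continuous_on_coordinatewise_then_product)
  show "continuous_on UNIV (\<lambda>x. translate J l x i)" for i
    by (cases "i \<in> J") (auto simp: translate_def intro!: continuous_on_add continuous_on_const continuous_on_eval)
qed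

lemma translate_cube:
  assumes "x \<in> cube b" "\<And>i. \<bar>l i\<bar> \<le> L"
  shows "translate J l x \<in> cube (b + L)"
  unfolding cube_def
proof (intro CollectI allI)
  fix i
  show "\<bar>translate J l x i\<bar> \<le> b + L"
    using cubeD[OF assms(1), of i] assms(2)[of i] by (auto simp: translate_def)
qed

lemma translate_inverse: "translate J (\<lambda>i. - l i) (translate J l x) = x"
  "translate J l (translate J (\<lambda>i. - l i) x) = x"
  by (auto simp: translate_def)

lemma squeeze_factor:
  assumes "finite J" "J \<noteq> {}" "0 < \<eta>" "\<eta> \<le> 1"
  shows "\<eta> \<le> 1 - min (MAX j\<in>J. \<bar>y j - l j\<bar>) (1 - \<eta>)" "1 - min (MAX j\<in>J. \<bar>y j - l j\<bar>) (1 - \<eta>) \<le> (1::real)"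
proof -
  obtain j where "j \<in> J" using assms(2) by blast
  then have "\<bar>y j - l j\<bar> \<le> (MAX j\<in>J. \<bar>y j - l j\<bar>)"
    using assms(1) by (intro Max_ge) auto
  then have "0 \<le> (MAX j\<in>J. \<bar>y j - l j\<bar>)"
    by linarith
  then show "1 - min (MAX j\<in>J. \<bar>y j - l j\<bar>) (1 - \<eta>) \<le> 1"
    using assms by simp
qed simp

lemma continuous_squeeze_factor:
  assumes "finite J" "J \<noteq> {}"
  shows "continuous_on UNIV (\<lambda>y :: nat \<Rightarrow> real. 1 - min (MAX j\<in>J. \<bar>y j - l j\<bar>) (1 - \<eta>))"
  by (intro continuous_on_diff continuous_on_const continuous_on_min continuous_on_Max assms
      continuous_on_rabs continuous_on_eval)

lemma continuous_squeeze:
  assumes "finite J" "J \<noteq> {}"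
  shows "continuous_on UNIV (squeeze \<eta> P J l m)"
proof (rule continuous_on_coordinatewise_then_product)
  show "continuous_on UNIV (\<lambda>y. squeeze \<eta> P J l m y i)" for i
  proof (cases "i \<in> P - J")
    case True
    then show ?thesis
      unfolding squeeze_def
      by (simp del: Diff_iff) (intro continuous_on_add continuous_on_const continuous_on_mult continuous_on_diff continuous_on_eval
          continuous_squeeze_factor[OF assms, of l \<eta>])
  next
    case False
    then show ?thesis by (simp add: squeeze_def continuous_on_eval del: Diff_iff)
  qed
qed

lemma squeeze_cube:
  assumes "finite J" "J \<noteq> {}" "0 < \<eta>" "\<eta> \<le> 1" "y \<in> cube b" "\<And>i. \<bar>m i\<bar> \<le> L"
  shows "squeeze \<eta> P J l m y \<in> cube (b + 2 * L)"
  unfolding cube_def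
proof (intro CollectI allI)
  fix i
  let ?r = "1 - min (MAX j\<in>J. \<bar>y j - l j\<bar>) (1 - \<eta>)"
  have yi: "\<bar>y i\<bar> \<le> b" and mi: "\<bar>m i\<bar> \<le> L" using cubeD[OF assms(5)] assms(6) by auto
  have "\<bar>(y i - m i) * ?r\<bar> \<le> (b + L) * 1"
    unfolding abs_mult using squeeze_factor[OF assms(1-4), of y l] \<open>0 < \<eta>\<close> yi mi
    by (intro mult_mono) auto
  then show "\<bar>squeeze \<eta> P J l m y i\<bar> \<le> b + 2 * L"
    using yi mi unfolding squeeze_def by (simp del: abs_mult_pos) linarith
qed

lemma compact_flat_pairs: "compact (flat_pairs P N K b J l J' m)"
  unfolding flat_pairs_def case_prod_unfold
  by (intro compact_continuous_image compact_fibre_pairs continuous_on_Pair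
      continuous_on_compose2[OF continuous_translate] continuous_on_fst continuous_on_snd continuous_on_id) auto

lemma flat_pairs_subset:
  assumes "\<And>i. \<bar>l i\<bar> \<le> L" "\<And>i. \<bar>m i\<bar> \<le> L"
  shows "flat_pairs P N K b J l J' m \<subseteq> cube (b + L) \<times> cube (b + L)"
  unfolding flat_pairs_def using fibre_pairs_subset by (fastforce intro!: translate_cube assms)

lemma compact_cone_pairs:
  assumes "finite J" "J \<noteq> {}"
  shows "compact (cone_pairs \<eta> P N K b J l m)"
  unfolding cone_pairs_def case_prod_unfold
  by (intro compact_continuous_image compact_fibre_pairs continuous_on_Pair
      continuous_on_compose2[OF continuous_translate] continuous_on_compose2[OF continuous_squeeze[OF assms]]
      continuous_on_fst continuous_on_snd continuous_on_id) auto

lemma cone_pairs_subset: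
  assumes "finite J" "J \<noteq> {}" "0 < \<eta>" "\<eta> \<le> 1" "\<And>i. \<bar>l i\<bar> \<le> L" "\<And>i. \<bar>m i\<bar> \<le> L"
  shows "cone_pairs \<eta> P N K b J l m \<subseteq> cube (b + 2 * L) \<times> cube (b + 2 * L)"
proof -
  have "L \<ge> 0" using assms(5)[of 0] by linarith
  have "translate J l x \<in> cube (b + 2 * L)" if "x \<in> cube b" for x
    using translate_cube[where L=L, OF that assms(5)] cube_mono[of "b + L" "b + 2 * L"] \<open>L \<ge> 0\<close> by auto
  then show ?thesis
    unfolding cone_pairs_def using fibre_pairs_subset squeeze_cube[where L=L, OF assms(1-4) _ assms(6)] by fastforce
qed

lemma flat_pairs_converse: "(flat_pairs P N K b J l J' m)\<inverse> = flat_pairs P K N b J' m J l"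
proof -
  have "flat_pairs P K N b J' m J l = (\<lambda>(x,y). (translate J' m x, translate J l y)) ` (fibre_pairs {} ((P - J) \<union> N) ((P - J') \<union> K) b)\<inverse>"
    unfolding fibre_pairs_converse flat_pairs_def ..
  then show ?thesis
    unfolding flat_pairs_def by force
qed

context Metric_space begin

lemma can_separate_flat_pairs:
  assumes "can_separate (fibre_pairs {} ((P - J) \<union> N) ((P - J') \<union> K) b)"
    and L: "\<And>i. \<bar>l i\<bar> \<le> L" "\<And>i. \<bar>m i\<bar> \<le> L"
  shows "can_separate (flat_pairs P N K b J l J' m)"
  unfolding flat_pairs_def
proof (rule can_separate_image[OF assms(1)])
  show "\<exists>c. \<forall>x\<in>cube a. translate J (\<lambda>i. - l i) x \<in> cube c" for a
    using translate_cube[of _ a "\<lambda>i. - l i" L] L by auto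
  show "\<exists>c. \<forall>x\<in>cube a. translate J' (\<lambda>i. - m i) x \<in> cube c" for a
    using translate_cube[of _ a "\<lambda>i. - m i" L] L by auto
qed (auto simp: translate_inverse continuous_translate)

text \<open>\<open>squeeze\<close> fixes the \<open>J\<close>-coordinates, on which alone its factor
  depends, so dividing by the same factor inverts it. The lower bound \<eta> on the factor makes the
  inverse continuous and bounded on cubes.\<close>

lemma can_separate_cone_pairs:
  assumes "can_separate (fibre_pairs (P - J) N (K \<union> J) b)" and J: "finite J" "J \<noteq> {}" and \<eta>: "0 < \<eta>" "\<eta> \<le> 1"
    and L: "\<And>i. \<bar>l i\<bar> \<le> L" "\<And>i. \<bar>m i\<bar> \<le> L"
  shows "can_separate (cone_pairs \<eta> P N K b J l m)"
proof -
  define r where "r y = 1 - min (MAX j\<in>J. \<bar>y j - l j\<bar>) (1 - \<eta>)" for y :: "nat \<Rightarrow> real"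
  have r: "\<eta> \<le> r y" "r y \<le> 1" for y
    unfolding r_def using squeeze_factor[OF J \<eta>] by auto
  have r_cong: "r y = r z" if "\<And>j. j \<in> J \<Longrightarrow> y j = z j" for y z
    using that unfolding r_def by (metis (no_types, lifting) image_cong)
  have sq: "squeeze \<eta> P J l m = (\<lambda>y i. if i \<in> P - J then m i + (y i - m i) * r y else y i)"
    unfolding squeeze_def r_def by (intro ext) auto
  define un where "un y = (\<lambda>i. if i \<in> P - J then m i + (y i - m i) / r y else y i)" for y
  have r0: "r y \<noteq> 0" for y
    using r[of y] \<eta> by auto
  have "r (squeeze \<eta> P J l m y) = r y" for y
    by (rule r_cong) (simp add: sq)
  then have inv1: "un (squeeze \<eta> P J l m y) = y" for y
    using r0 by (auto simp: un_def sq)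
  have "r (un y) = r y" for y
    by (rule r_cong) (simp add: un_def)
  then have inv2: "squeeze \<eta> P J l m (un y) = y" for y
    using r0 by (auto simp: un_def sq)
  have cont_un: "continuous_on UNIV un"
  proof (rule continuous_on_coordinatewise_then_product)
    show "continuous_on UNIV (\<lambda>y. un y i)" for i
    proof (cases "i \<in> P - J")
      case True
      have "continuous_on UNIV r"
        unfolding r_def using continuous_squeeze_factor[OF J, of l \<eta>] by simp
      then have "continuous_on UNIV (\<lambda>y. m i + (y i - m i) / r y)"
        using r0 by (intro continuous_on_add continuous_on_const continuous_on_divide continuous_on_diff continuous_on_eval) auto
      with True show ?thesis by (simp add: un_def)
    next
      case False
      then show ?thesis by (simp add: un_def continuous_on_eval del: Diff_iff)
    qed
  qed
  have "un y \<in> cube (L + (\<bar>a\<bar> + L) / \<eta> + \<bar>a\<bar>)" if "y \<in> cube a" for a y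
    unfolding cube_def
  proof (intro CollectI allI)
    fix i
    have yi: "\<bar>y i\<bar> \<le> \<bar>a\<bar>" and mi: "\<bar>m i\<bar> \<le> L" using cubeD[OF that, of i] L by auto
    have "\<bar>y i - m i\<bar> / r y \<le> (\<bar>a\<bar> + L) / \<eta>"
      using yi mi r[of y] \<eta> by (intro frac_le) auto
    moreover have "\<bar>(y i - m i) / r y\<bar> = \<bar>y i - m i\<bar> / r y"
      using r[of y] \<eta> by (simp add: abs_divide)
    moreover have "0 \<le> \<bar>y i - m i\<bar> / r y"
      using r[of y] \<eta> by simp
    ultimately have *: "\<bar>m i + (y i - m i) / r y\<bar> \<le> L + (\<bar>a\<bar> + L) / \<eta>" "0 \<le> L + (\<bar>a\<bar> + L) / \<eta>"
      using yi mi abs_triangle_ineq[of "m i" "(y i - m i) / r y"] by linarith+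
    show "\<bar>un y i\<bar> \<le> L + (\<bar>a\<bar> + L) / \<eta> + \<bar>a\<bar>"
    proof (cases "i \<in> P - J")
      case True
      then have "un y i = m i + (y i - m i) / r y" by (simp add: un_def)
      then show ?thesis using * yi by linarith
    next
      case False
      then have "un y i = y i" by (simp only: un_def if_False)
      then show ?thesis using * yi by linarith
    qed
  qed
  then have bd: "\<exists>c. \<forall>y\<in>cube a. un y \<in> cube c" for a by blast
  have bd2: "\<exists>c. \<forall>x\<in>cube a. translate J (\<lambda>i. - l i) x \<in> cube c" for a
    using translate_cube[of _ a "\<lambda>i. - l i" L] L by auto
  show ?thesis
    unfolding cone_pairs_def
    by (rule can_separate_image[OF assms(1) continuous_translate continuous_translate translate_inverse bd2
          continuous_squeeze[OF J] cont_un inv1 inv2 bd])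
qed

end

text \<open>If a point at distance \<open>t\<close> from the even integers (hence \<open>1 - t\<close> from the odd ones) is
  moved by \<open>shift t c\<close> towards the even integers, then for \<open>c \<le> 1/2\<close> the interval \<open>t \<le> c\<close>
  collapses; moving it by the same amount away from them, the interval \<open>t \<ge> c\<close> collapses onto
  the odd integers for \<open>c \<ge> 1/2\<close>. In join coordinates this is \<open>c \<mapsto> max 0 (2c - 1)\<close> and
  \<open>c \<mapsto> min 1 (2c)\<close>. The maxima in the denominators only avoid division by zero.\<close>

definition shift :: "real \<Rightarrow> real \<Rightarrow> real" where
  "shift t c = min (t * min 1 ((1 - c) / max c (1/2))) ((1 - t) * min 1 (c / max (1 - c) (1/2)))"

text \<open>Lets large \<open>c\<close> be treated as small \<open>c\<close> with even and odd
  integers, and the two maps, exchanged.\<close>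

lemma shift_dual: "shift (1 - t) (1 - c) = shift t c"
  by (simp add: shift_def min.commute)

lemma shift_below:
  assumes "0 \<le> t" "t \<le> c" "c \<le> 1/2"
  shows "shift t c = t"
proof -
  have "t * (1 - c) \<le> (1 - t) * c"
    using assms by (simp add: algebra_simps)
  then have "t \<le> (1 - t) * (c / (1 - c))"
    using assms by (simp add: field_simps)
  moreover have "min 1 (c / max (1 - c) (1/2)) = c / (1 - c)"
    using assms by (auto simp: max_def min_def field_simps)
  moreover have "min 1 ((1 - c) / max c (1/2)) = 1"
    using assms by (auto simp: max_def min_def field_simps)
  ultimately show ?thesis by (simp add: shift_def)
qed

lemma shift_above:
  assumes "c \<le> t" "t \<le> 1" "0 \<le> c" "c \<le> 1/2"
  shows "shift t c = (1 - t) * c / (1 - c)"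
proof -
  have "(1 - t) * c \<le> t * (1 - c)"
    using assms by (simp add: algebra_simps)
  then have "(1 - t) * (c / (1 - c)) \<le> t"
    using assms by (simp add: field_simps)
  moreover have "min 1 (c / max (1 - c) (1/2)) = c / (1 - c)"
    using assms by (auto simp: max_def min_def field_simps)
  moreover have "min 1 ((1 - c) / max c (1/2)) = 1"
    using assms by (auto simp: max_def min_def field_simps)
  ultimately show ?thesis by (simp add: shift_def)
qed

lemma shift_bounds:
  assumes "t \<in> {0..1}" "c \<in> {0..1}"
  shows "0 \<le> shift t c" "shift t c \<le> t" "shift t c \<le> 1 - t"
proof -
  have "0 \<le> min 1 ((1 - c) / max c (1/2))" "0 \<le> min 1 (c / max (1 - c) (1/2))"
    using assms by (auto intro!: divide_nonneg_nonneg)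
  then show "0 \<le> shift t c"
    using assms by (auto simp: shift_def)
  have 1: "t * min 1 ((1 - c) / max c (1/2)) \<le> t"
    using assms(1) by (intro mult_right_le_one_le) (use assms in \<open>auto intro!: divide_nonneg_nonneg\<close>)
  have 2: "(1 - t) * min 1 (c / max (1 - c) (1/2)) \<le> 1 - t"
    using assms(1) by (intro mult_right_le_one_le) (use assms in \<open>auto intro!: divide_nonneg_nonneg\<close>)
  show "shift t c \<le> t"
    unfolding shift_def by (rule order_trans[OF min.cobounded1 1])
  show "shift t c \<le> 1 - t"
    unfolding shift_def by (rule order_trans[OF min.cobounded2 2])
qed

lemma continuous_shift:
  assumes "continuous_on S a" "continuous_on S b"
  shows "continuous_on S (\<lambda>x. shift (a x) (b x))"
  unfolding shift_def using assms
  by (intro continuous_on_min continuous_on_mult continuous_on_divide continuous_on_diff continuous_on_max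
      continuous_on_const) auto

text \<open>The sign jumps only at zeros of \<open>w\<close>, where a bounded factor meets one that
  tends to 0.\<close>

lemma continuous_on_mult_sgn:
  fixes a w :: "'x::t2_space \<Rightarrow> real"
  assumes a: "continuous_on UNIV a" and w: "continuous_on UNIV w" and "\<And>x. w x = 0 \<Longrightarrow> a x = 0"
  shows "continuous_on UNIV (\<lambda>x. sgn (w x) * a x)"
proof -
  have "isCont (\<lambda>x. sgn (w x) * a x) x" for x
  proof (cases "w x = 0")
    case True
    have ax: "a x = 0" using True assms(3) by blast
    have "((\<lambda>y. \<bar>a y\<bar>) \<longlongrightarrow> \<bar>a x\<bar>) (at x)"
      using a by (intro tendsto_rabs) (auto simp: continuous_on_eq_continuous_at isCont_def)
    then have lim: "((\<lambda>y. \<bar>a y\<bar>) \<longlongrightarrow> 0) (at x)"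
      by (simp add: ax)
    have "((\<lambda>y. \<bar>sgn (w y) * a y\<bar>) \<longlongrightarrow> 0) (at x)"
      by (rule tendsto_sandwich[OF _ _ tendsto_const lim]) (auto simp: abs_mult sgn_if)
    then have "((\<lambda>y. sgn (w y) * a y) \<longlongrightarrow> 0) (at x)"
      by (rule tendsto_rabs_zero_cancel)
    then show ?thesis using ax by (simp add: isCont_def)
  next
    case False
    then show ?thesis
      using a w by (intro continuous_mult isCont_sgn) (auto simp: continuous_on_eq_continuous_at)
  qed
  then show ?thesis by (simp add: continuous_on_eq_continuous_at)
qed

section \<open>Distance and direction to the nearest even integer\<close>

definition dist_even :: "real \<Rightarrow> real" where
  "dist_even v = arccos (cos (pi * v)) / pi"

definition even_near :: "real \<Rightarrow> real" where
  "even_near v = 2 * real_of_int (round (v / 2))"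

text \<open>The value at even integers is an arbitrary choice, and \<open>side\<close> jumps at all
  integers. It matters only when multiplied by a shift, which vanishes there.\<close>

definition side :: "real \<Rightarrow> real" where
  "side v = (if v \<ge> even_near v then 1 else -1)"

lemma side: "\<bar>side v\<bar> = 1" "side v \<in> \<int>" "even_near v \<in> \<int>"
  by (auto simp: side_def even_near_def)

text \<open>Subtracting an even integer changes neither \<open>cos (pi * v)\<close> nor
  \<open>sin (pi * v)\<close>. The former yields \<open>dist_even\<close> as a continuous triangle
  wave, the latter has the sign of the offset.\<close>

lemma even_near_position:
  shows "v = even_near v + side v * dist_even v"
    and "0 < dist_even v \<Longrightarrow> dist_even v < 1 \<Longrightarrow> sgn (sin (pi * v)) = side v"
proof -
  define z where "z = round (v / 2)"
  define l where "l = even_near v"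
  define s where "s = side v"
  define t where "t = \<bar>v - l\<bar>"
  have l_def': "l = 2 * real_of_int z" by (simp add: l_def even_near_def z_def)
  have s_def': "s = (if v \<ge> l then 1 else -1)" by (simp add: s_def side_def l_def)
  have "\<bar>v / 2 - real_of_int z\<bar> \<le> 1/2"
    unfolding z_def using of_int_round_abs_le[of "v/2"] by (simp add: abs_minus_commute)
  then have t: "0 \<le> t" "t \<le> 1"
    unfolding t_def l_def' by linarith+
  have v: "v = l + s * t" by (auto simp: s_def' t_def)
  have eq: "pi * v = 2 * pi * real_of_int z + pi * (s * t)"
    using v by (simp add: l_def' algebra_simps)
  have "cos (pi * v) = cos (pi * (s * t))"
    unfolding eq cos_add by simp
  also have "\<dots> = cos (pi * t)"
    by (auto simp: s_def')
  finally have dt: "dist_even v = t"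
    using t by (simp add: dist_even_def arccos_cos mult_le_cancel_left1)
  have "sin (pi * v) = sin (pi * (s * t))"
    unfolding eq sin_add by simp
  also have "\<dots> = s * sin (pi * t)"
    by (auto simp: s_def')
  finally have "sgn (sin (pi * v)) = s" if "0 < t" "t < 1"
    using that sin_gt_zero[of "pi * t"] by (simp add: sgn_mult s_def')
  then show "0 < dist_even v \<Longrightarrow> dist_even v < 1 \<Longrightarrow> sgn (sin (pi * v)) = side v"
    unfolding dt by (simp add: s_def)
  show "v = even_near v + side v * dist_even v"
    unfolding dt using v by (simp add: s_def l_def)
qed

lemma dist_even_range: "dist_even v \<in> {0..1}"
proof -
  have "0 \<le> arccos (cos (pi * v))" "arccos (cos (pi * v)) \<le> pi"
    by (auto intro!: arccos_lbound arccos_ubound)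
  then show ?thesis by (simp add: dist_even_def)
qed

lemma continuous_dist_even:
  fixes a :: "'x::t2_space \<Rightarrow> real"
  assumes "continuous_on S a"
  shows "continuous_on S (\<lambda>x. dist_even (a x))"
  unfolding dist_even_def using assms
  by (intro continuous_on_divide continuous_on_arccos) (auto intro!: continuous_intros)

text \<open>The \<open>r\<close>-th smallest value of \<open>t\<close> on \<open>P\<close>, written
  as a minimum of maxima so that continuity is inherited.\<close>

definition order_stat :: "nat set \<Rightarrow> nat \<Rightarrow> (nat \<Rightarrow> real) \<Rightarrow> real" where
  "order_stat P r t = (MIN J\<in>{J. J \<subseteq> P \<and> card J = r}. MAX j\<in>J. t j)"

text \<open>An \<open>r\<close>-set attaining the minimum lies in the weak sublevel set, while
  \<open>r\<close> strictly smaller values would produce a smaller maximum. Both counts are needed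
  because of ties, and they turn into each other's analogues under
  \<open>t \<mapsto> 1 - t\<close>.\<close>

lemma order_stat:
  assumes "finite P" "0 < r" "r \<le> card P"
  shows "card {i \<in> P. t i < order_stat P r t} < r" "r \<le> card {i \<in> P. t i \<le> order_stat P r t}"
    "order_stat P r t \<in> t ` P"
proof -
  let ?S = "{J. J \<subseteq> P \<and> card J = r}"
  let ?c = "order_stat P r t"
  have fin: "finite ?S" using assms(1) by simp
  obtain J0 where "J0 \<subseteq> P" "card J0 = r" by (rule obtain_subset_with_card_n[OF assms(3)])
  then have ne: "?S \<noteq> {}" by blast
  have finJ: "finite J" "J \<noteq> {}" if "J \<in> ?S" for J
    using that assms(1,2) by (auto intro: finite_subset)
  have "?c \<in> (\<lambda>J. MAX j\<in>J. t j) ` ?S"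
    unfolding order_stat_def using fin ne by (intro Min_in) auto
  then obtain J where J: "J \<in> ?S" "?c = (MAX j\<in>J. t j)" by auto
  have "?c \<in> t ` J"
    unfolding J(2) using finJ[OF J(1)] by (intro Max_in) auto
  then show "?c \<in> t ` P" using J(1) by auto
  have "t j \<le> ?c" if "j \<in> J" for j
    unfolding J(2) using finJ[OF J(1)] that by (intro Max_ge) auto
  then have "card J \<le> card {i \<in> P. t i \<le> ?c}"
    using J(1) assms(1) by (intro card_mono) auto
  then show "r \<le> card {i \<in> P. t i \<le> ?c}" using J(1) by simp
  show "card {i \<in> P. t i < ?c} < r"
  proof (rule ccontr)
    assume "\<not> ?thesis"
    then have "r \<le> card {i \<in> P. t i < ?c}" by simp
    then obtain I where I: "I \<subseteq> {i \<in> P. t i < ?c}" "card I = r"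
      by (rule obtain_subset_with_card_n)
    then have IS: "I \<in> ?S" by auto
    have "?c \<le> (MAX j\<in>I. t j)"
      unfolding order_stat_def using fin IS by (intro Min_le) auto
    moreover have "(MAX j\<in>I. t j) \<in> t ` I"
      using finJ[OF IS] by (intro Max_in) auto
    ultimately show False using I(1) by auto
  qed
qed

lemma continuous_order_stat:
  assumes "finite P" "0 < r" "r \<le> card P" "\<And>i. i \<in> P \<Longrightarrow> continuous_on S (\<lambda>x. t x i)"
  shows "continuous_on S (\<lambda>x. order_stat P r (t x))"
  unfolding order_stat_def
proof (rule continuous_on_Min)
  show "finite {J. J \<subseteq> P \<and> card J = r}" using assms(1) by simp
  obtain J0 where "J0 \<subseteq> P" "card J0 = r" by (rule obtain_subset_with_card_n[OF assms(3)])
  then show "{J. J \<subseteq> P \<and> card J = r} \<noteq> {}" by blast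
  fix J assume "J \<in> {J. J \<subseteq> P \<and> card J = r}"
  then show "continuous_on S (\<lambda>x. MAX j\<in>J. t x j)"
    using assms by (intro continuous_on_Max) (auto intro: finite_subset)
qed

text \<open>Coordinates in \<open>J\<close>, those with small \<open>t\<close>, collapse to
  \<open>l\<close> in \<open>x\<close> and double their offset in \<open>y\<close>. For the other
  parameters \<open>y i - m i\<close> is \<open>1 - 2 * c\<close> times \<open>x i - m i\<close>,
  and \<open>2 * c\<close> is the largest \<open>J\<close>-offset of \<open>y\<close>: precisely a
  \<open>squeeze\<close>. Where the cone is cut off, \<open>1 - 2 * c < \<eta>\<close> puts
  \<open>y\<close> close to the dual skeleton.\<close>

lemma cone_pairs_or_near_flat_pairs:
  assumes P: "finite P" "card P = Suc (m1 + m2)"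
    and c: "0 \<le> c" "c \<le> 1/2"
    and t: "\<And>i. i \<in> P \<Longrightarrow> t i \<in> {0..1}" and s: "\<And>i. i \<in> P \<Longrightarrow> \<bar>s i\<bar> = 1" and m: "\<And>i. i \<in> P \<Longrightarrow> m i = l i + s i"
    and x: "\<And>i. i \<in> P \<Longrightarrow> x i = l i + s i * (t i - shift (t i) c)"
    and y: "\<And>i. i \<in> P \<Longrightarrow> y i = l i + s i * (t i + shift (t i) c)"
    and supp: "\<And>i. i \<notin> P \<union> N \<Longrightarrow> x i = 0" "\<And>i. i \<notin> P \<union> K \<Longrightarrow> y i = 0"
    and cube: "x \<in> cube b" "y \<in> cube b"
    and card: "card {i \<in> P. t i < c} \<le> m2" "Suc m2 \<le> card {i \<in> P. t i \<le> c}"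
    and "0 < \<eta>"
  shows "\<exists>J\<subseteq>P. card J = Suc m2 \<and> ((x, y) \<in> cone_pairs \<eta> P N K b J l m \<or>
     (\<exists>J'\<subseteq>P. card J' = Suc m1 \<and> (\<exists>y'. (x, y') \<in> flat_pairs P N K b J l J' m \<and> (\<forall>i. \<bar>y i - y' i\<bar> \<le> \<eta>))))"
proof -
  \<comment> \<open>With ties at \<open>c\<close>, neither sublevel set need have exactly
    \<open>Suc m2\<close> elements; any set of that size between them will do.\<close>
  have "\<exists>J. {i \<in> P. t i < c} \<subseteq> J \<and> J \<subseteq> {i \<in> P. t i \<le> c} \<and> card J = Suc m2"
    using P(1) card by (intro exists_subset_between) (auto intro: card_mono)
  then obtain J where J: "{i \<in> P. t i < c} \<subseteq> J" "J \<subseteq> {i \<in> P. t i \<le> c}" "card J = Suc m2"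
    by blast
  have JP: "J \<subseteq> P" using J(2) by auto
  have tJ: "t j \<le> c" if "j \<in> J" for j using that J(2) by auto
  have tnJ: "c \<le> t i" if "i \<in> P" "i \<notin> J" for i using that J(1) by force
  have finJ: "finite J" using J(3) by (metis card.infinite nat.distinct(1))
  \<comment> \<open>Fewer than \<open>Suc m2\<close> values lie strictly below \<open>c\<close>, so
    some member of \<open>J\<close> has value \<open>c\<close>; it makes the cone height exactly
    \<open>2 * c\<close>.\<close>
  have "J \<noteq> {i \<in> P. t i < c}" using J(3) card(1) by auto
  then obtain j0 where j0: "j0 \<in> J" "t j0 = c" using J(1,2) by force
  have b0: "0 \<le> b" using cubeD[OF cube(1), of 0] by linarith
  have xJ: "x j = l j" and yJ: "y j = l j + s j * (2 * t j)" if "j \<in> J" for j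
  proof -
    have j: "j \<in> P" using that JP by auto
    have "shift (t j) c = t j"
      using tJ[OF that] t[OF j] c by (intro shift_below) auto
    then show "x j = l j" "y j = l j + s j * (2 * t j)"
      using x[OF j] y[OF j] by simp_all
  qed
  have above: "shift (t i) c = (1 - t i) * c / (1 - c)" if "i \<in> P" "c \<le> t i" for i
    using that t[of i] c by (intro shift_above) auto
  have ym: "y i = m i - s i * ((1 - t i) * (1 - 2 * c) / (1 - c))" if "i \<in> P" "c \<le> t i" for i
  proof -
    have "t i + shift (t i) c = 1 - (1 - t i) * (1 - 2 * c) / (1 - c)"
      unfolding above[OF that] using c by (simp add: divide_simps) (simp add: algebra_simps)
    moreover have "y i = m i - s i * Q" if "t i + shift (t i) c = 1 - Q" for Q
      unfolding y[OF \<open>i \<in> P\<close>] m[OF \<open>i \<in> P\<close>] that by (simp add: algebra_simps)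
    ultimately show ?thesis by blast
  qed
  have xm: "x i = m i - s i * ((1 - t i) / (1 - c))" if "i \<in> P" "c \<le> t i" for i
  proof -
    have "t i - shift (t i) c = 1 - (1 - t i) / (1 - c)"
      unfolding above[OF that] using c by (simp add: divide_simps) (simp add: algebra_simps)
    moreover have "x i = m i - s i * Q" if "t i - shift (t i) c = 1 - Q" for Q
      unfolding x[OF \<open>i \<in> P\<close>] m[OF \<open>i \<in> P\<close>] that by (simp add: algebra_simps)
    ultimately show ?thesis by blast
  qed
  define x0 where "x0 = (\<lambda>i. if i \<in> J then 0 else x i)"
  have x0: "translate J l x0 = x" "x0 \<in> cube b" "\<And>i. i \<notin> (P - J) \<union> N \<Longrightarrow> x0 i = 0"
    using xJ cubeD[OF cube(1)] b0 supp(1) JP by (auto simp: x0_def translate_def cube_def)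
  show ?thesis
  proof (cases "2 * c \<le> 1 - \<eta>")
    case True
    \<comment> \<open>The preimage of \<open>y\<close> under \<open>squeeze\<close> must share the
      parameters outside \<open>J\<close> with \<open>x\<close>, so they are copied from
      \<open>x\<close>.\<close>
    define y0 where "y0 = (\<lambda>i. if i \<in> P - J then x i else y i)"
    have "(x0, y0) \<in> fibre_pairs (P - J) N (K \<union> J) b"
      using x0(2,3) cubeD[OF cube(1)] cubeD[OF cube(2)] supp(2) by (auto simp: fibre_pairs_def y0_def x0_def cube_def)
    moreover have "squeeze \<eta> P J l m y0 = y"
    proof -
      have "(MAX j\<in>J. \<bar>y0 j - l j\<bar>) = 2 * c"
      proof (rule Max_eqI)
        show "finite ((\<lambda>j. \<bar>y0 j - l j\<bar>) ` J)" using finJ by simp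
        have yl: "\<bar>y0 j - l j\<bar> = 2 * t j" if "j \<in> J" for j
          using that yJ[OF that] t[of j] s[of j] JP by (auto simp: y0_def abs_mult)
        show "a \<le> 2 * c" if "a \<in> (\<lambda>j. \<bar>y0 j - l j\<bar>) ` J" for a
          using that yl J(2) by auto
        show "2 * c \<in> (\<lambda>j. \<bar>y0 j - l j\<bar>) ` J"
          using yl[OF j0(1)] j0 by (intro image_eqI[of _ _ j0]) auto
      qed
      then have r: "1 - min (MAX j\<in>J. \<bar>y0 j - l j\<bar>) (1 - \<eta>) = 1 - 2 * c"
        using True by simp
      show ?thesis
      proof
        fix i
        show "squeeze \<eta> P J l m y0 i = y i"
        proof (cases "i \<in> P - J")
          case True
          then have "c \<le> t i" using J(1) by force
          then show ?thesis
            using True xm[of i] ym[of i] unfolding squeeze_def r by (simp add: y0_def)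
        qed (auto simp: squeeze_def y0_def)
      qed
    qed
    ultimately have "(x, y) \<in> cone_pairs \<eta> P N K b J l m"
      unfolding cone_pairs_def using x0(1) by (intro image_eqI[of _ _ "(x0, y0)"]) auto
    then show ?thesis using J(3) JP by blast
  next
    case False
    \<comment> \<open>At most \<open>m2\<close> of the \<open>Suc (m1 + m2)\<close> values lie below
      \<open>c\<close>, which leaves \<open>Suc m1\<close> coordinates that can be replaced by
      \<open>m\<close>, each at a cost of at most \<open>1 - 2 * c\<close>.\<close>
    have "{i \<in> P. c \<le> t i} = P - {i \<in> P. t i < c}" by auto
    then have "card {i \<in> P. c \<le> t i} = card P - card {i \<in> P. t i < c}"
      using P(1) by (simp add: card_Diff_subset)
    then have "Suc m1 \<le> card {i \<in> P. c \<le> t i}"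
      using card(1) P(2) by linarith
    then obtain J' where J': "J' \<subseteq> {i \<in> P. c \<le> t i}" "card J' = Suc m1"
      by (rule obtain_subset_with_card_n)
    define y' where "y' = (\<lambda>i. if i \<in> J' then m i else y i)"
    define y0 where "y0 = (\<lambda>i. if i \<in> J' then 0 else y i)"
    have "(x0, y0) \<in> fibre_pairs {} ((P - J) \<union> N) ((P - J') \<union> K) b"
      using x0(2,3) cubeD[OF cube(2)] b0 supp(2) J'(1) by (auto simp: fibre_pairs_def y0_def cube_def)
    moreover have "translate J' m y0 = y'"
      by (auto simp: translate_def y0_def y'_def)
    ultimately have "(x, y') \<in> flat_pairs P N K b J l J' m"
      unfolding flat_pairs_def using x0(1) by (intro image_eqI[of _ _ "(x0, y0)"]) auto
    moreover have "\<bar>y i - y' i\<bar> \<le> \<eta>" for i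
    proof (cases "i \<in> J'")
      case True
      then have i: "i \<in> P" "c \<le> t i" using J'(1) by auto
      have "(1 - t i) / (1 - c) \<le> 1" "0 \<le> (1 - t i) / (1 - c)"
        using i t[OF i(1)] c by (auto simp: divide_simps)
      then have "\<bar>(1 - t i) / (1 - c)\<bar> \<le> 1"
        by (simp only: abs_of_nonneg)
      then have "\<bar>(1 - t i) / (1 - c) * (1 - 2 * c)\<bar> \<le> 1 * (1 - 2 * c)"
        unfolding abs_mult using c by (intro mult_mono) auto
      moreover have "\<bar>y i - y' i\<bar> = \<bar>(1 - t i) / (1 - c) * (1 - 2 * c)\<bar>"
        using ym[OF i] True s[OF i(1)] by (simp add: y'_def abs_mult)
      ultimately have "\<bar>y i - y' i\<bar> \<le> 1 - 2 * c" by (simp only: mult_1_left)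
      then show ?thesis using False by linarith
    qed (use \<open>0 < \<eta>\<close> in \<open>simp add: y'_def\<close>)
    moreover have "J' \<subseteq> P" using J'(1) by auto
    ultimately show ?thesis using J(3) JP J'(2) by blast
  qed
qed

section \<open>Separation over a join\<close>

lemma finite_integral_points:
  assumes "finite P"
  shows "finite {l. (\<forall>i\<in>P. l i \<in> \<int> \<and> \<bar>l i\<bar> \<le> (L::real)) \<and> (\<forall>i. i \<notin> P \<longrightarrow> l i = 0)}"
proof -
  have "finite (real_of_int ` {-\<lceil>L\<rceil>..\<lceil>L\<rceil>})" by simp
  then have "finite {l. \<forall>i. (i \<in> P \<longrightarrow> l i \<in> real_of_int ` {-\<lceil>L\<rceil>..\<lceil>L\<rceil>}) \<and> (i \<notin> P \<longrightarrow> l i = 0)}"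
    by (rule finite_set_of_finite_funs[OF assms])
  moreover have "v \<in> real_of_int ` {-\<lceil>L\<rceil>..\<lceil>L\<rceil>}" if v: "v \<in> \<int>" "\<bar>v\<bar> \<le> L" for v
  proof -
    obtain z where "v = real_of_int z" using v(1) by (rule Ints_cases)
    moreover have "z \<in> {-\<lceil>L\<rceil>..\<lceil>L\<rceil>}"
      using v(2) \<open>v = real_of_int z\<close> by (simp add: abs_le_iff) linarith
    ultimately show ?thesis by blast
  qed
  ultimately show ?thesis
    by (elim rev_finite_subset) blast
qed

context Metric_space begin

text \<open>A quarter of the margin pays for each of four moves: \<open>x0\<close> to
  \<open>x\<close>, \<open>f1\<close> to \<open>f2\<close>, and the same for \<open>g\<close>. The
  constants are found before \<open>f2\<close> and \<open>g2\<close>, so the sets over which those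
  are separated may depend on \<eta>.\<close>

lemma separated_after_homotopy:
  assumes E: "compact E" "E \<subseteq> cube c0 \<times> cube c0" "\<And>x y. (x, y) \<in> E \<Longrightarrow> f1 x \<noteq> g1 y"
    and f1: "continuous_map euclidean mtopology f1" and g1: "continuous_map euclidean mtopology g1"
  obtains \<eta> \<mu> where "0 < \<eta>" "\<eta> \<le> 1" "0 < \<mu>"
    "\<And>f2 g2 x y x0 y0. \<lbrakk>close_homotopic f1 f2 \<mu> c1; close_homotopic g1 g2 \<mu> c1; x \<in> cube c1; y \<in> cube c1;
      (x0, y0) \<in> E; \<forall>i. \<bar>x i - x0 i\<bar> \<le> \<eta>; \<forall>i. \<bar>y i - y0 i\<bar> \<le> \<eta>\<rbrakk> \<Longrightarrow> f2 x \<noteq> g2 y"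
proof -
  obtain \<mu> where \<mu>: "\<mu> > 0" "\<And>x y. (x,y) \<in> E \<Longrightarrow> \<mu> \<le> d (f1 x) (g1 y)"
    by (rule positive_margin[OF f1 g1 E(1,3)]) (simp, rule that)
  have "\<mu>/4 > 0" using \<mu> by simp
  define B where "B = max c0 c1"
  obtain Tf \<delta>f where f: "\<delta>f > 0" "\<forall>x\<in>cube B. \<forall>y\<in>cube B. (\<forall>i<Tf. \<bar>x i - y i\<bar> \<le> \<delta>f) \<longrightarrow> d (f1 x) (f1 y) < \<mu>/4"
    by (rule uniform_on_cube[OF f1 \<open>\<mu>/4 > 0\<close>, of B]) (rule that)
  obtain Tg \<delta>g where g: "\<delta>g > 0" "\<forall>x\<in>cube B. \<forall>y\<in>cube B. (\<forall>i<Tg. \<bar>x i - y i\<bar> \<le> \<delta>g) \<longrightarrow> d (g1 x) (g1 y) < \<mu>/4"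
    by (rule uniform_on_cube[OF g1 \<open>\<mu>/4 > 0\<close>, of B]) (rule that)
  define \<eta> where "\<eta> = min 1 (min \<delta>f \<delta>g)"
  have "f2 x \<noteq> g2 y" if h: "close_homotopic f1 f2 (\<mu>/4) c1" "close_homotopic g1 g2 (\<mu>/4) c1"
     and xy: "x \<in> cube c1" "y \<in> cube c1" and x0y0: "(x0, y0) \<in> E"
     and near: "\<forall>i. \<bar>x i - x0 i\<bar> \<le> \<eta>" "\<forall>i. \<bar>y i - y0 i\<bar> \<le> \<eta>" for f2 g2 x y x0 y0
  proof
    assume eq: "f2 x = g2 y"
    have B: "x \<in> cube B" "y \<in> cube B" "x0 \<in> cube B" "y0 \<in> cube B"
      using xy x0y0 E(2) cube_mono[of c0 B] cube_mono[of c1 B] by (auto simp: B_def)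
    have 1: "d (f1 x) (f1 x0) < \<mu>/4"
      using f(2)[THEN bspec, THEN bspec, OF B(1,3)] near(1) by (auto simp: \<eta>_def)
    have 2: "d (g1 y) (g1 y0) < \<mu>/4"
      using g(2)[THEN bspec, THEN bspec, OF B(2,4)] near(2) by (auto simp: \<eta>_def)
    have 3: "d (f1 x) (f2 x) < \<mu>/4" "d (g1 y) (g2 y) < \<mu>/4"
      using close_homotopicD[OF h(1) xy(1)] close_homotopicD[OF h(2) xy(2)] by auto
    note inM = cont_in_M[OF f1] cont_in_M[OF g1] cont_in_M[OF close_homotopic_cont(2)[OF h(1)]]
        cont_in_M[OF close_homotopic_cont(2)[OF h(2)]]
    have "d (f1 x0) (g1 y0) \<le> d (f1 x0) (f1 x) + d (f1 x) (g1 y0)"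
      by (intro triangle inM)
    moreover have "d (f1 x) (g1 y0) \<le> d (f1 x) (f2 x) + d (f2 x) (g1 y0)"
      by (intro triangle inM)
    moreover have "d (g2 y) (g1 y0) \<le> d (g2 y) (g1 y) + d (g1 y) (g1 y0)"
      by (intro triangle inM)
    ultimately have "d (f1 x0) (g1 y0) < \<mu>"
      using 1 2 3 commute[of "f1 x0" "f1 x"] commute[of "g2 y" "g1 y"] unfolding eq by linarith
    then show False using \<mu>(2)[OF x0y0] by simp
  qed
  moreover have "0 < \<eta>" "\<eta> \<le> 1"
    using f g by (auto simp: \<eta>_def)
  ultimately show ?thesis
    using \<open>\<mu>/4 > 0\<close> by (intro that[of \<eta> "\<mu>/4"]) blast+
qed

text \<open>The case of the integer lattice: coordinates move by at most 1, and the smallness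
  hypotheses say that this changes \<open>f\<close> and \<open>g\<close> by less than
  \<open>e\<close>.\<close>

lemma can_separate_join_lattice:
  assumes P: "finite P" "card P = Suc (m1 + m2)"
    and H0: "\<And>J J' b. J \<subseteq> P \<Longrightarrow> J' \<subseteq> P \<Longrightarrow> card J = Suc m2 \<Longrightarrow> card J' = Suc m1 \<Longrightarrow>
       can_separate (fibre_pairs {} ((P - J) \<union> N) ((P - J') \<union> K) b)"
    and H1: "\<And>J b. J \<subseteq> P \<Longrightarrow> card J = Suc m2 \<Longrightarrow> can_separate (fibre_pairs (P - J) N (K \<union> J) b)"
    and H2: "\<And>J b. J \<subseteq> P \<Longrightarrow> card J = Suc m1 \<Longrightarrow> can_separate (fibre_pairs (P - J) (N \<union> J) K b)"
    and f: "continuous_map euclidean mtopology f" and g: "continuous_map euclidean mtopology g"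
    and "e > 0" "b \<ge> 0"
    and small_f: "\<And>x y. x \<in> cube b \<Longrightarrow> (\<forall>i. \<bar>x i - y i\<bar> \<le> 1) \<Longrightarrow> d (f x) (f y) < e"
    and small_g: "\<And>x y. x \<in> cube b \<Longrightarrow> (\<forall>i. \<bar>x i - y i\<bar> \<le> 1) \<Longrightarrow> d (g x) (g y) < e"
  obtains f' g' where "close_homotopic f f' (3 * e) b" "close_homotopic g g' (3 * e) b"
    "\<And>x y. (x, y) \<in> fibre_pairs P N K b \<Longrightarrow> f' x \<noteq> g' y"
proof -
  \<comment> \<open>A nearest even integer lies within 1 of a coordinate in \<open>cube b\<close>,
    and \<open>m\<close> differs from \<open>l\<close> by one more unit.\<close>
  define L where "L = b + 2"
  define \<Lambda> where "\<Lambda> = {l. (\<forall>i\<in>P. l i \<in> \<int> \<and> \<bar>l i\<bar> \<le> L) \<and> (\<forall>i. i \<notin> P \<longrightarrow> l i = 0)}"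
  have \<Lambda>_fin: "finite \<Lambda>"
    unfolding \<Lambda>_def by (rule finite_integral_points[OF P(1)])
  have \<Lambda>_bd: "\<bar>l i\<bar> \<le> L" if "l \<in> \<Lambda>" for l i
    using that \<open>b \<ge> 0\<close> by (cases "i \<in> P") (auto simp: \<Lambda>_def L_def)
  define \<J>1 where "\<J>1 = {J. J \<subseteq> P \<and> card J = Suc m2}"
  define \<J>2 where "\<J>2 = {J. J \<subseteq> P \<and> card J = Suc m1}"
  have \<J>_fin: "finite \<J>1" "finite \<J>2"
    using P(1) by (auto simp: \<J>1_def \<J>2_def)
  have \<J>D: "finite J" "J \<noteq> {}" if "J \<in> \<J>1 \<union> \<J>2" for J
    using that P(1) by (auto simp: \<J>1_def \<J>2_def intro: finite_subset)
  define I0 where "I0 = (\<J>1 \<times> \<Lambda>) \<times> (\<J>2 \<times> \<Lambda>)"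
  define E0 where "E0 = (\<Union>p\<in>I0. flat_pairs P N K (b + 1) (fst (fst p)) (snd (fst p)) (fst (snd p)) (snd (snd p)))"
  have I0_fin: "finite I0" unfolding I0_def by (intro finite_cartesian_product \<J>_fin \<Lambda>_fin)
  define c0 where "c0 = b + 1 + L"
  have E0: "can_separate E0" "compact E0" "E0 \<subseteq> cube c0 \<times> cube c0"
  proof -
    have *: "can_separate (flat_pairs P N K (b + 1) J l J' m)" "flat_pairs P N K (b + 1) J l J' m \<subseteq> cube c0 \<times> cube c0"
      if "((J,l),(J',m)) \<in> I0" for J l J' m
    proof -
      have "J \<subseteq> P" "J' \<subseteq> P" "card J = Suc m2" "card J' = Suc m1" and lm: "l \<in> \<Lambda>" "m \<in> \<Lambda>"
        using that by (auto simp: I0_def \<J>1_def \<J>2_def)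
      then show "can_separate (flat_pairs P N K (b + 1) J l J' m)"
        by (intro can_separate_flat_pairs[OF H0, where L=L] \<Lambda>_bd)
      show "flat_pairs P N K (b + 1) J l J' m \<subseteq> cube c0 \<times> cube c0"
        unfolding c0_def by (intro flat_pairs_subset \<Lambda>_bd lm)
    qed
    have **: "can_separate (flat_pairs P N K (b + 1) (fst (fst p)) (snd (fst p)) (fst (snd p)) (snd (snd p)))"
      "flat_pairs P N K (b + 1) (fst (fst p)) (snd (fst p)) (fst (snd p)) (snd (snd p)) \<subseteq> cube c0 \<times> cube c0"
      if "p \<in> I0" for p
      using that by (auto intro!: *(1) del: subsetI) (rule *(2), simp)
    show "can_separate E0" "compact E0" "E0 \<subseteq> cube c0 \<times> cube c0"
      unfolding E0_def by (intro can_separate_UN[where c = c0] compact_UN UN_least I0_fin ** compact_flat_pairs; assumption)+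
  qed
  define B where "B = b + 1"
  obtain f1 g1 where f1: "close_homotopic f f1 (e/2) B" and g1: "close_homotopic g g1 (e/2) B"
    and dis0: "\<And>x y. (x, y) \<in> E0 \<Longrightarrow> f1 x \<noteq> g1 y"
    by (rule can_separateD[OF E0(1) f g, of "e/2" B]) (use \<open>e > 0\<close> that in auto)
  note cont1 = close_homotopic_cont(2)[OF f1] close_homotopic_cont(2)[OF g1]
  obtain \<eta> \<mu> where \<eta>: "0 < \<eta>" "\<eta> \<le> 1" and \<mu>: "0 < \<mu>" and
    near: "\<And>f2 g2 x y x0 y0. \<lbrakk>close_homotopic f1 f2 \<mu> B; close_homotopic g1 g2 \<mu> B; x \<in> cube B; y \<in> cube B;
      (x0, y0) \<in> E0; \<forall>i. \<bar>x i - x0 i\<bar> \<le> \<eta>; \<forall>i. \<bar>y i - y0 i\<bar> \<le> \<eta>\<rbrakk> \<Longrightarrow> f2 x \<noteq> g2 y"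
    by (rule separated_after_homotopy[OF E0(2,3) dis0 cont1, of B]) (assumption, rule that)
  define c1 where "c1 = b + 1 + 2 * L"
  define E1 where "E1 = (\<Union>p\<in>\<J>1 \<times> \<Lambda> \<times> \<Lambda>. cone_pairs \<eta> P N K (b + 1) (fst p) (fst (snd p)) (snd (snd p)))"
  \<comment> \<open>Beyond \<open>c = 1/2\<close> the maps exchange roles; the pairs are recorded as
    \<open>(y, x)\<close>, so \<open>E2\<close> enters through its converse.\<close>
  define E2 where "E2 = (\<Union>p\<in>\<J>2 \<times> \<Lambda> \<times> \<Lambda>. cone_pairs \<eta> P K N (b + 1) (fst p) (fst (snd p)) (snd (snd p)))"
  have fin12: "finite (\<J>1 \<times> \<Lambda> \<times> \<Lambda>)" "finite (\<J>2 \<times> \<Lambda> \<times> \<Lambda>)"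
    by (intro finite_cartesian_product \<J>_fin \<Lambda>_fin)+
  have E1: "can_separate E1" "compact E1" "E1 \<subseteq> cube c1 \<times> cube c1"
  proof -
    have *: "can_separate (cone_pairs \<eta> P N K (b + 1) (fst p) (fst (snd p)) (snd (snd p)))"
       "compact (cone_pairs \<eta> P N K (b + 1) (fst p) (fst (snd p)) (snd (snd p)))"
       "cone_pairs \<eta> P N K (b + 1) (fst p) (fst (snd p)) (snd (snd p)) \<subseteq> cube c1 \<times> cube c1"
       if p: "p \<in> \<J>1 \<times> \<Lambda> \<times> \<Lambda>" for p
    proof -
      have J: "fst p \<in> \<J>1 \<union> \<J>2" "fst p \<subseteq> P" "card (fst p) = Suc m2" and lm: "fst (snd p) \<in> \<Lambda>" "snd (snd p) \<in> \<Lambda>"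
        using p by (auto simp: \<J>1_def)
      show "can_separate (cone_pairs \<eta> P N K (b + 1) (fst p) (fst (snd p)) (snd (snd p)))"
        by (rule can_separate_cone_pairs[OF H1 \<J>D \<eta>, where L=L]) (use J in \<open>simp_all add: lm \<Lambda>_bd\<close>)
      show "compact (cone_pairs \<eta> P N K (b + 1) (fst p) (fst (snd p)) (snd (snd p)))"
        by (rule compact_cone_pairs[OF \<J>D[OF J(1)]])
      show "cone_pairs \<eta> P N K (b + 1) (fst p) (fst (snd p)) (snd (snd p)) \<subseteq> cube c1 \<times> cube c1"
        unfolding c1_def by (rule cone_pairs_subset[OF \<J>D[OF J(1)] \<eta>]) (rule \<Lambda>_bd, rule lm)+
    qed
    show "can_separate E1" "compact E1" "E1 \<subseteq> cube c1 \<times> cube c1"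
      unfolding E1_def by (intro can_separate_UN[where c = c1] compact_UN UN_least fin12 *; assumption)+
  qed
  have E2: "can_separate E2"
  proof -
    have *: "can_separate (cone_pairs \<eta> P K N (b + 1) (fst p) (fst (snd p)) (snd (snd p)))"
       "compact (cone_pairs \<eta> P K N (b + 1) (fst p) (fst (snd p)) (snd (snd p)))"
       "cone_pairs \<eta> P K N (b + 1) (fst p) (fst (snd p)) (snd (snd p)) \<subseteq> cube c1 \<times> cube c1"
       if p: "p \<in> \<J>2 \<times> \<Lambda> \<times> \<Lambda>" for p
    proof -
      have J: "fst p \<in> \<J>1 \<union> \<J>2" "fst p \<subseteq> P" "card (fst p) = Suc m1" and lm: "fst (snd p) \<in> \<Lambda>" "snd (snd p) \<in> \<Lambda>"
        using p by (auto simp: \<J>2_def)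
      have "can_separate (fibre_pairs (P - fst p) K (N \<union> fst p) (b+1))"
        using can_separate_converse[OF H2[OF J(2,3), of "b+1"]] by (simp only: fibre_pairs_converse)
      then show "can_separate (cone_pairs \<eta> P K N (b + 1) (fst p) (fst (snd p)) (snd (snd p)))"
        by (rule can_separate_cone_pairs[OF _ \<J>D \<eta>, where L=L]) (use J in \<open>simp_all add: lm \<Lambda>_bd\<close>)
      show "compact (cone_pairs \<eta> P K N (b + 1) (fst p) (fst (snd p)) (snd (snd p)))"
        by (rule compact_cone_pairs[OF \<J>D[OF J(1)]])
      show "cone_pairs \<eta> P K N (b + 1) (fst p) (fst (snd p)) (snd (snd p)) \<subseteq> cube c1 \<times> cube c1"
        unfolding c1_def by (rule cone_pairs_subset[OF \<J>D[OF J(1)] \<eta>]) (rule \<Lambda>_bd, rule lm)+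
    qed
    show "can_separate E2"
      unfolding E2_def by (intro can_separate_UN[where c = c1] fin12 *; assumption)
  qed
  have E12: "can_separate (E1 \<union> E2\<inverse>)"
    by (rule can_separate_Un[OF E1(1) can_separate_converse[OF E2] E1(2,3)])
  \<comment> \<open>Below \<mu> to preserve the separation near \<open>E0\<close>, below
    \<open>e/2\<close> to keep both moves together within \<open>e\<close>.\<close>
  have em: "min (e/2) \<mu> > 0" using \<open>e > 0\<close> \<mu> by simp
  obtain f2 g2 where f2: "close_homotopic f1 f2 (min (e/2) \<mu>) B" and g2: "close_homotopic g1 g2 (min (e/2) \<mu>) B"
    and dis12: "\<And>x y. (x, y) \<in> E1 \<union> E2\<inverse> \<Longrightarrow> f2 x \<noteq> g2 y"
    by (rule can_separateD[OF E12 cont1 em, of B]) (rule that)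
  have f2\<mu>: "close_homotopic f1 f2 \<mu> B" and g2\<mu>: "close_homotopic g1 g2 \<mu> B"
    using close_homotopic_mono[OF f2] close_homotopic_mono[OF g2] by auto
  have "close_homotopic f f2 (e/2 + e/2) B"
    by (rule close_homotopic_trans[OF f1 close_homotopic_mono[OF f2]]) auto
  then have ff2: "close_homotopic f f2 e B" by simp
  have "close_homotopic g g2 (e/2 + e/2) B"
    by (rule close_homotopic_trans[OF g1 close_homotopic_mono[OF g2]]) auto
  then have gg2: "close_homotopic g g2 e B" by simp

  define c where "c x = order_stat P (Suc m2) (\<lambda>i. dist_even (x i))" for x :: "nat \<Rightarrow> real"
  have r: "0 < Suc m2" "Suc m2 \<le> card P" using P(2) by auto
  have cont_c: "continuous_on UNIV c"
    unfolding c_def by (rule continuous_order_stat[OF P(1) r continuous_dist_even[OF continuous_on_eval]])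
  have c01: "c x \<in> {0..1}" for x
    using order_stat(3)[OF P(1) r, of "\<lambda>i. dist_even (x i)"] dist_even_range by (auto simp: c_def)
  \<comment> \<open>\<open>sgn (sin _)\<close> replaces \<open>side\<close> for the sake of
    continuity; they agree wherever the shift is nonzero.\<close>
  define S where "S x i = sgn (sin (pi * x i)) * shift (dist_even (x i)) (c x)" for x :: "nat \<Rightarrow> real" and i
  have S_eq: "S x i = side (x i) * shift (dist_even (x i)) (c x)" for x i
  proof (cases "0 < dist_even (x i) \<and> dist_even (x i) < 1")
    case True
    then show ?thesis using even_near_position(2)[of "x i"] by (simp add: S_def)
  next
    case False
    then have "shift (dist_even (x i)) (c x) = 0"
      using shift_bounds[OF dist_even_range[of "x i"] c01[of x]] dist_even_range[of "x i"] by auto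
    then show ?thesis by (simp add: S_def)
  qed
  have S_le: "\<bar>S x i\<bar> \<le> 1" for x i
    using shift_bounds[OF dist_even_range[of "x i"] c01[of x]] dist_even_range[of "x i"] side(1)[of "x i"]
    by (auto simp: S_eq abs_mult)
  have cont_S: "continuous_on UNIV (\<lambda>x. S x i)" for i
    unfolding S_def
  proof (rule continuous_on_mult_sgn)
    show "continuous_on UNIV (\<lambda>x. shift (dist_even (x i)) (c x))"
      by (intro continuous_shift continuous_dist_even continuous_on_eval cont_c)
    show "continuous_on UNIV (\<lambda>x :: nat \<Rightarrow> real. sin (pi * x i))"
      by (intro continuous_on_sin continuous_on_mult continuous_on_const continuous_on_eval)
    show "shift (dist_even (x i)) (c x) = 0" if "sin (pi * x i) = 0" for x
    proof (rule ccontr)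
      assume "shift (dist_even (x i)) (c x) \<noteq> 0"
      then have "0 < dist_even (x i)" "dist_even (x i) < 1"
        using shift_bounds[OF dist_even_range[of "x i"] c01[of x]] by auto
      then show False
        using even_near_position(2)[of "x i"] that side(1)[of "x i"] by simp
    qed
  qed
  \<comment> \<open>Sign -1 moves towards the even integers and is used for \<open>f\<close>; sign 1
    moves away from them and is used for \<open>g\<close>.\<close>
  define mv where "mv \<sigma> x = (\<lambda>i. if i \<in> P then x i + \<sigma> * S x i else x i)" for \<sigma> :: real and x :: "nat \<Rightarrow> real"
  have cont_mv: "continuous_on UNIV (mv \<sigma>)" for \<sigma>
  proof (rule continuous_on_coordinatewise_then_product)
    show "continuous_on UNIV (\<lambda>x. mv \<sigma> x i)" for i
      unfolding mv_def by (cases "i \<in> P")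
        (auto intro!: continuous_on_add continuous_on_mult continuous_on_const continuous_on_eval cont_S)
  qed
  have mv_cube: "mv \<sigma> x \<in> cube B" if "x \<in> cube b" "\<bar>\<sigma>\<bar> = 1" for \<sigma> x
    unfolding cube_def
  proof (intro CollectI allI)
    fix i
    have "\<bar>\<sigma> * S x i\<bar> \<le> 1" using S_le[of x i] that(2) by (simp add: abs_mult)
    then show "\<bar>mv \<sigma> x i\<bar> \<le> B"
      using cubeD[OF that(1), of i] by (auto simp: mv_def B_def)
  qed
  have mv_small: "\<forall>i. \<bar>x i - ((1 - t) * x i + t * mv \<sigma> x i)\<bar> \<le> 1" if "t \<in> {0..1}" "\<bar>\<sigma>\<bar> = 1" for \<sigma> x t
  proof
    fix i
    have "x i - ((1 - t) * x i + t * mv \<sigma> x i) = (if i \<in> P then - (t * (\<sigma> * S x i)) else 0)"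
      by (simp add: mv_def algebra_simps)
    moreover have "\<bar>t * (\<sigma> * S x i)\<bar> \<le> 1"
      using that S_le[of x i] by (simp add: abs_mult mult_le_one)
    ultimately show "\<bar>x i - ((1 - t) * x i + t * mv \<sigma> x i)\<bar> \<le> 1" by simp
  qed
  have hf: "close_homotopic f (\<lambda>x. f2 (mv (-1) x)) (3 * e) b"
  proof -
    have "close_homotopic f (\<lambda>x. f (mv (-1) x)) e b"
      by (rule close_homotopic_reparam[OF f cont_mv]) (simp add: small_f mv_small)
    moreover have "close_homotopic (\<lambda>x. f (mv (-1) x)) (\<lambda>x. f2 (mv (-1) x)) e b"
      by (rule close_homotopic_precompose[OF ff2 cont_mv]) (simp add: mv_cube)
    ultimately have "close_homotopic f (\<lambda>x. f2 (mv (-1) x)) (e + e) b"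
      by (rule close_homotopic_trans)
    then show ?thesis by (rule close_homotopic_mono) (use \<open>e > 0\<close> in auto)
  qed
  have hg: "close_homotopic g (\<lambda>x. g2 (mv 1 x)) (3 * e) b"
  proof -
    have "close_homotopic g (\<lambda>x. g (mv 1 x)) e b"
      by (rule close_homotopic_reparam[OF g cont_mv]) (simp add: small_g mv_small)
    moreover have "close_homotopic (\<lambda>x. g (mv 1 x)) (\<lambda>x. g2 (mv 1 x)) e b"
      by (rule close_homotopic_precompose[OF gg2 cont_mv]) (simp add: mv_cube)
    ultimately have "close_homotopic g (\<lambda>x. g2 (mv 1 x)) (e + e) b"
      by (rule close_homotopic_trans)
    then show ?thesis by (rule close_homotopic_mono) (use \<open>e > 0\<close> in auto)
  qed
  have "f2 (mv (-1) x) \<noteq> g2 (mv 1 y)" if xy: "(x, y) \<in> fibre_pairs P N K b" for x y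
  proof -
    have xb: "x \<in> cube b" and yb: "y \<in> cube b" and eqP: "\<And>i. i \<in> P \<Longrightarrow> y i = x i"
      and supp: "\<And>i. i \<notin> P \<union> N \<Longrightarrow> x i = 0" "\<And>i. i \<notin> P \<union> K \<Longrightarrow> y i = 0"
      using xy by (auto simp: fibre_pairs_def)
    let ?x = "mv (-1) x" and ?y = "mv 1 y"
    have cube: "?x \<in> cube (b + 1)" "?y \<in> cube (b + 1)"
      using mv_cube[OF xb, of "-1"] mv_cube[OF yb, of 1] by (auto simp: B_def)
    define t where "t i = dist_even (x i)" for i
    \<comment> \<open>The value 0 outside \<open>P\<close> places both \<open>l\<close> and
      \<open>m = l + s\<close> in the finite set \<Lambda>.\<close>
    define s where "s i = (if i \<in> P then side (x i) else 0)" for i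
    define l where "l i = (if i \<in> P then even_near (x i) else 0)" for i
    define m where "m i = l i + s i" for i
    have t01: "t i \<in> {0..1}" for i using dist_even_range by (simp add: t_def)
    have s1: "\<bar>s i\<bar> = 1" if "i \<in> P" for i using that side by (simp add: s_def)
    have pos: "x i = l i + s i * t i" if "i \<in> P" for i
      using that even_near_position(1)[of "x i"] by (simp add: l_def s_def t_def)
    \<comment> \<open>\<open>c\<close> depends only on the parameters, on which \<open>x\<close> and
      \<open>y\<close> agree; hence both points are moved with the same \<open>c\<close>.\<close>
    have "order_stat P (Suc m2) (\<lambda>i. dist_even (y i)) = order_stat P (Suc m2) (\<lambda>i. dist_even (x i))"
    proof -
      have "(MAX j\<in>J. dist_even (y j)) = (MAX j\<in>J. dist_even (x j))" if "J \<subseteq> P" for J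
        using that eqP by (metis (mono_tags, lifting) image_cong subsetD)
      then show ?thesis
        unfolding order_stat_def by (intro arg_cong[where f = Min] image_cong) auto
    qed
    then have cy: "c y = c x" by (simp add: c_def)
    have Sx: "S x i = s i * shift (t i) (c x)" "S y i = s i * shift (t i) (c x)" if "i \<in> P" for i
      using that eqP[OF that] by (simp_all add: S_eq s_def t_def cy)
    have x': "?x i = l i + s i * (t i - shift (t i) (c x))" if "i \<in> P" for i
      using that pos[OF that] Sx[OF that] by (simp add: mv_def algebra_simps)
    have y': "?y i = l i + s i * (t i + shift (t i) (c x))" if "i \<in> P" for i
      using that pos[OF that] Sx[OF that] eqP[OF that] by (simp add: mv_def algebra_simps)
    have supp': "?x i = 0" if "i \<notin> P \<union> N" for i
      using that supp(1)[of i] by (simp add: mv_def)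
    have supp'': "?y i = 0" if "i \<notin> P \<union> K" for i
      using that supp(2)[of i] by (simp add: mv_def)
    have lm: "l \<in> \<Lambda>" "m \<in> \<Lambda>"
    proof -
      have int: "l i \<in> \<int>" "s i \<in> \<int>" for i
        using side by (auto simp: l_def s_def)
      have "\<bar>l i\<bar> \<le> b + 1" if "i \<in> P" for i
      proof -
        have "\<bar>s i * t i\<bar> \<le> 1" using s1[OF that] t01[of i] by (simp add: abs_mult)
        then show ?thesis using pos[OF that] cubeD[OF xb, of i] by linarith
      qed
      then have bd: "\<bar>l i\<bar> \<le> L" "\<bar>m i\<bar> \<le> L" if "i \<in> P" for i
        using s1[OF that] that by (fastforce simp: m_def L_def)+
      have zero: "l i = 0" "m i = 0" if "i \<notin> P" for i
        using that by (auto simp: m_def l_def s_def)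
      show "l \<in> \<Lambda>" "m \<in> \<Lambda>"
        using int bd zero by (auto simp: \<Lambda>_def m_def[of i for i])
    qed
    have card: "card {i \<in> P. t i < c x} \<le> m2" "Suc m2 \<le> card {i \<in> P. t i \<le> c x}"
      using order_stat(1,2)[OF P(1) r, of "\<lambda>i. dist_even (x i)"] by (auto simp: c_def t_def)
    have E0I: "f2 ?x \<noteq> g2 ?y" if "J \<subseteq> P" "card J = Suc m2" "J' \<subseteq> P" "card J' = Suc m1"
       "(x0, y0) \<in> flat_pairs P N K (b + 1) J l J' m"
       "\<forall>i. \<bar>?x i - x0 i\<bar> \<le> \<eta>" "\<forall>i. \<bar>?y i - y0 i\<bar> \<le> \<eta>" for J J' x0 y0
    proof (rule near[OF f2\<mu> g2\<mu> _ _ _ that(6,7)])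
      show "(x0, y0) \<in> E0"
        unfolding E0_def using that lm by (intro UN_I[of "((J,l),(J',m))"]) (auto simp: I0_def \<J>1_def \<J>2_def)
    qed (use cube in \<open>auto simp: B_def\<close>)
    show ?thesis
    proof (cases "c x \<le> 1/2")
      case True
      have "\<exists>J\<subseteq>P. card J = Suc m2 \<and> ((?x, ?y) \<in> cone_pairs \<eta> P N K (b + 1) J l m \<or>
        (\<exists>J'\<subseteq>P. card J' = Suc m1 \<and> (\<exists>y'. (?x, y') \<in> flat_pairs P N K (b + 1) J l J' m \<and> (\<forall>i. \<bar>?y i - y' i\<bar> \<le> \<eta>))))"
        using c01[of x] True
        by (intro cone_pairs_or_near_flat_pairs[OF P _ _ t01 s1 _ x' y' supp' supp'' cube card \<eta>(1)]) (auto simp: m_def)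
      then obtain J where J: "J \<subseteq> P" "card J = Suc m2" and alt: "(?x, ?y) \<in> cone_pairs \<eta> P N K (b + 1) J l m \<or>
        (\<exists>J'\<subseteq>P. card J' = Suc m1 \<and> (\<exists>y'. (?x, y') \<in> flat_pairs P N K (b + 1) J l J' m \<and> (\<forall>i. \<bar>?y i - y' i\<bar> \<le> \<eta>)))"
        by (elim exE conjE) (rule that)
      from alt show ?thesis
      proof
        assume "(?x, ?y) \<in> cone_pairs \<eta> P N K (b + 1) J l m"
        then have "(?x, ?y) \<in> E1"
          unfolding E1_def using J lm by (intro UN_I[of "(J,l,m)"]) (auto simp: \<J>1_def)
        then show ?thesis by (intro dis12) auto
      next
        assume "\<exists>J'\<subseteq>P. card J' = Suc m1 \<and> (\<exists>y'. (?x, y') \<in> flat_pairs P N K (b + 1) J l J' m \<and> (\<forall>i. \<bar>?y i - y' i\<bar> \<le> \<eta>))"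
        then show ?thesis
          by (elim exE conjE) (rule E0I[OF J], assumption+, use \<eta>(1) in auto)
      qed
    next
      case False
      \<comment> \<open>Taking complements exchanges strict and weak inequalities, so
        \<open>1 - c x\<close> takes the place of \<open>c x\<close> for the values
        \<open>1 - t i\<close>, with \<open>m1\<close> for \<open>m2\<close>. At the same time
        \<open>l\<close> and \<open>m\<close> swap and \<open>s\<close> changes sign.\<close>
      have less: "{i \<in> P. 1 - t i < 1 - c x} = P - {i \<in> P. t i \<le> c x}" by auto
      have le: "{i \<in> P. 1 - t i \<le> 1 - c x} = P - {i \<in> P. t i < c x}" by auto
      have "card {i \<in> P. 1 - t i < 1 - c x} = card P - card {i \<in> P. t i \<le> c x}"
        "card {i \<in> P. 1 - t i \<le> 1 - c x} = card P - card {i \<in> P. t i < c x}"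
        unfolding less le using P(1) by (simp_all add: card_Diff_subset)
      then have card': "card {i \<in> P. 1 - t i < 1 - c x} \<le> m1" "Suc m1 \<le> card {i \<in> P. 1 - t i \<le> 1 - c x}"
        using card P(2) by linarith+
      have P': "card P = Suc (m2 + m1)" using P(2) by simp
      have y'': "?y i = m i + - s i * (1 - t i - shift (1 - t i) (1 - c x))" if "i \<in> P" for i
        using y'[OF that] by (simp add: shift_dual m_def algebra_simps)
      have x'': "?x i = m i + - s i * (1 - t i + shift (1 - t i) (1 - c x))" if "i \<in> P" for i
        using x'[OF that] by (simp add: shift_dual m_def algebra_simps)
      have "\<exists>J'\<subseteq>P. card J' = Suc m1 \<and> ((?y, ?x) \<in> cone_pairs \<eta> P K N (b + 1) J' m l \<or>
        (\<exists>J\<subseteq>P. card J = Suc m2 \<and> (\<exists>x'. (?y, x') \<in> flat_pairs P K N (b + 1) J' m J l \<and> (\<forall>i. \<bar>?x i - x' i\<bar> \<le> \<eta>))))"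
        using c01[of x] False t01 s1
        by (intro cone_pairs_or_near_flat_pairs[OF P(1) P' _ _ _ _ _ y'' x'' supp'' supp' cube(2,1) card' \<eta>(1)]) (auto simp: m_def)
      then obtain J' where J': "J' \<subseteq> P" "card J' = Suc m1" and alt: "(?y, ?x) \<in> cone_pairs \<eta> P K N (b + 1) J' m l \<or>
        (\<exists>J\<subseteq>P. card J = Suc m2 \<and> (\<exists>x'. (?y, x') \<in> flat_pairs P K N (b + 1) J' m J l \<and> (\<forall>i. \<bar>?x i - x' i\<bar> \<le> \<eta>)))"
        by (elim exE conjE) (rule that)
      from alt show ?thesis
      proof
        assume "(?y, ?x) \<in> cone_pairs \<eta> P K N (b + 1) J' m l"
        then have "(?y, ?x) \<in> E2"
          unfolding E2_def using J' lm by (intro UN_I[of "(J',m,l)"]) (auto simp: \<J>2_def)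
        then show ?thesis by (intro dis12) auto
      next
        assume "\<exists>J\<subseteq>P. card J = Suc m2 \<and> (\<exists>x'. (?y, x') \<in> flat_pairs P K N (b + 1) J' m J l \<and> (\<forall>i. \<bar>?x i - x' i\<bar> \<le> \<eta>))"
        then obtain J x0 where J: "J \<subseteq> P" "card J = Suc m2" "(?y, x0) \<in> flat_pairs P K N (b + 1) J' m J l"
          "\<forall>i. \<bar>?x i - x0 i\<bar> \<le> \<eta>"
          by (elim exE conjE) (rule that)
        have "(x0, ?y) \<in> flat_pairs P N K (b + 1) J l J' m"
          using J(3) unfolding flat_pairs_converse[of P N K "b+1" J l J' m, symmetric] by simp
        then show ?thesis
          by (rule E0I[OF J(1,2) J' _ J(4)]) (use \<eta>(1) in auto)
      qed
    qed
  qed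
  with hf hg show ?thesis by (rule that)
qed

end

section \<open>The multiplication formulas\<close>

lemma scale_cube:
  assumes "x \<in> cube b" "0 \<le> r"
  shows "(\<lambda>i. r * x i) \<in> cube (r * b)"
  using assms cubeD[OF assms(1)] by (auto simp: cube_def abs_mult intro!: mult_left_mono)

lemma continuous_scale: "continuous_on UNIV (\<lambda>(x :: nat \<Rightarrow> real) i. r * x i)"
proof (rule continuous_on_coordinatewise_then_product)
  show "continuous_on UNIV (\<lambda>x :: nat \<Rightarrow> real. r * x i)" for i
    by (intro continuous_on_mult continuous_on_const continuous_on_eval)
qed

context Metric_space begin

text \<open>Rescaling by a modulus of uniform continuity \<delta> turns a fine lattice into the
  integer lattice.\<close>

lemma can_separate_join:
  assumes P: "finite P" "card P = Suc (m1 + m2)"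
    and H0: "\<And>J J' b. J \<subseteq> P \<Longrightarrow> J' \<subseteq> P \<Longrightarrow> card J = Suc m2 \<Longrightarrow> card J' = Suc m1 \<Longrightarrow>
       can_separate (fibre_pairs {} ((P - J) \<union> N) ((P - J') \<union> K) b)"
    and H1: "\<And>J b. J \<subseteq> P \<Longrightarrow> card J = Suc m2 \<Longrightarrow> can_separate (fibre_pairs (P - J) N (K \<union> J) b)"
    and H2: "\<And>J b. J \<subseteq> P \<Longrightarrow> card J = Suc m1 \<Longrightarrow> can_separate (fibre_pairs (P - J) (N \<union> J) K b)"
  shows "can_separate (fibre_pairs P N K b)"
  unfolding can_separate_def
proof (intro allI impI)
  fix f g :: "(nat \<Rightarrow> real) \<Rightarrow> 'a" and e a :: real
  assume f: "continuous_map euclidean mtopology f" and g: "continuous_map euclidean mtopology g" and "e > 0"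
  define B where "B = max 0 (max a b)"
  have "e/3 > 0" using \<open>e > 0\<close> by simp
  obtain Tf \<delta>f where df: "\<delta>f > 0" "\<forall>x\<in>cube (B+1). \<forall>y\<in>cube (B+1). (\<forall>i<Tf. \<bar>x i - y i\<bar> \<le> \<delta>f) \<longrightarrow> d (f x) (f y) < e/3"
    by (rule uniform_on_cube[OF f \<open>e/3 > 0\<close>, of "B+1"]) (rule that)
  obtain Tg \<delta>g where dg: "\<delta>g > 0" "\<forall>x\<in>cube (B+1). \<forall>y\<in>cube (B+1). (\<forall>i<Tg. \<bar>x i - y i\<bar> \<le> \<delta>g) \<longrightarrow> d (g x) (g y) < e/3"
    by (rule uniform_on_cube[OF g \<open>e/3 > 0\<close>, of "B+1"]) (rule that)
  define \<delta> where "\<delta> = min 1 (min \<delta>f \<delta>g)"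
  have \<delta>: "0 < \<delta>" "\<delta> \<le> 1" "\<delta> \<le> \<delta>f" "\<delta> \<le> \<delta>g" using df(1) dg(1) by (auto simp: \<delta>_def)
  let ?s = "\<lambda>x i. \<delta> * x i :: real" and ?u = "\<lambda>x i. (1/\<delta>) * x i :: real"
  have su: "?s (?u x) = x" for x using \<delta>(1) by auto
  have close: "?s x \<in> cube (B+1)" "?s y \<in> cube (B+1)" "\<forall>i. \<bar>?s x i - ?s y i\<bar> \<le> \<delta>"
    if "x \<in> cube (B/\<delta>)" "\<forall>i. \<bar>x i - y i\<bar> \<le> 1" for x y
  proof -
    have sx: "?s x \<in> cube B"
      using scale_cube[OF that(1), of \<delta>] \<delta>(1) by simp
    have "\<bar>?s x i - ?s y i\<bar> = \<delta> * \<bar>x i - y i\<bar>" for i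
      using \<delta>(1) by (simp add: abs_mult flip: right_diff_distrib)
    then show near: "\<forall>i. \<bar>?s x i - ?s y i\<bar> \<le> \<delta>"
      using that(2) \<delta>(1) by simp
    show "?s x \<in> cube (B+1)" using sx cube_mono[of B "B+1"] by auto
    show "?s y \<in> cube (B+1)"
      unfolding cube_def
    proof (intro CollectI allI)
      fix i
      show "\<bar>?s y i\<bar> \<le> B + 1"
        using cubeD[OF sx, of i] near[THEN spec, of i] \<delta>(2) by linarith
    qed
  qed
  obtain f' g' where f': "close_homotopic (\<lambda>x. f (?s x)) f' (3 * (e/3)) (B/\<delta>)"
    and g': "close_homotopic (\<lambda>x. g (?s x)) g' (3 * (e/3)) (B/\<delta>)"
    and dis: "\<And>x y. (x, y) \<in> fibre_pairs P N K (B/\<delta>) \<Longrightarrow> f' x \<noteq> g' y"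
  proof (rule can_separate_join_lattice[OF P H0 H1 H2 cont_compose[OF f continuous_scale[of \<delta>]]
        cont_compose[OF g continuous_scale[of \<delta>]] \<open>e/3 > 0\<close>, where b = "B/\<delta>"])
    show "0 \<le> B/\<delta>" using \<delta>(1) by (simp add: B_def)
    fix x y :: "nat \<Rightarrow> real" assume xy: "x \<in> cube (B/\<delta>)" "\<forall>i. \<bar>x i - y i\<bar> \<le> 1"
    show "d (f (?s x)) (f (?s y)) < e/3"
      using df(2)[THEN bspec, THEN bspec, OF close(1,2)[OF xy]] close(3)[OF xy] \<delta>(3) by (meson order_trans)
    show "d (g (?s x)) (g (?s y)) < e/3"
      using dg(2)[THEN bspec, THEN bspec, OF close(1,2)[OF xy]] close(3)[OF xy] \<delta>(4) by (meson order_trans)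
  qed (assumption+, rule that)
  have u_cube: "?u x \<in> cube (B/\<delta>)" if "x \<in> cube c" "c \<le> B" for x c
    using scale_cube[of x B "1/\<delta>"] cube_mono[OF that(2)] that(1) \<delta>(1) by auto
  have aB: "a \<le> B" and bB: "b \<le> B" by (auto simp: B_def)
  have "close_homotopic (\<lambda>x. f (?s (?u x))) (\<lambda>x. f' (?u x)) (3 * (e/3)) a"
    by (rule close_homotopic_precompose[OF f' continuous_scale u_cube[OF _ aB]])
  then have 1: "close_homotopic f (\<lambda>x. f' (?u x)) e a" unfolding su by simp
  have "close_homotopic (\<lambda>x. g (?s (?u x))) (\<lambda>x. g' (?u x)) (3 * (e/3)) a"
    by (rule close_homotopic_precompose[OF g' continuous_scale u_cube[OF _ aB]])
  then have 2: "close_homotopic g (\<lambda>x. g' (?u x)) e a" unfolding su by simp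
  have "f' (?u x) \<noteq> g' (?u y)" if "(x, y) \<in> fibre_pairs P N K b" for x y
    using that u_cube[OF _ bB] by (intro dis) (auto simp: fibre_pairs_def)
  with 1 2 show "\<exists>f' g'. close_homotopic f f' e a \<and> close_homotopic g g' e a \<and> (\<forall>(x,y)\<in>fibre_pairs P N K b. f' x \<noteq> g' y)"
    by (intro exI[of _ "\<lambda>x. f' (?u x)"] exI[of _ "\<lambda>x. g' (?u x)"]) auto
qed

lemma enat_card_Un: "enat (card A) \<le> p \<Longrightarrow> enat (card B) \<le> q \<Longrightarrow> enat (card (A \<union> B)) \<le> p + q"
  by (rule order_trans[OF _ add_mono, of "card (A \<union> B)" "enat (card A)" "enat (card B)"])
     (use card_Un_le[of A B] in auto)

text \<open>Infinite \<open>m1\<close> or \<open>m2\<close> cause no trouble: for finite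
  \<open>P\<close> with \<open>Suc r\<close> elements, \<open>r\<close> splits as
  \<open>p + q\<close> with \<open>p\<close> and \<open>q\<close> bounded by \<open>m1\<close> and
  \<open>m2\<close>, and a join of dimensions \<open>p\<close> and \<open>q\<close> is used.\<close>

lemma DD_join:
  assumes H0: "DD_property 0 (n + m1) (k + m2) mtopology"
    and H1: "DD_property m1 n (k + (m2 + 1)) mtopology"
    and H2: "DD_property m2 (n + (m1 + 1)) k mtopology"
  shows "DD_property (m1 + m2 + 1) n k mtopology"
proof (rule DD_of_can_separate)
  fix P N K :: "nat set"
  assume fin: "finite P" "finite N" "finite K" and dis: "P \<inter> N = {}" "P \<inter> K = {}"
    and cP: "enat (card P) \<le> m1 + m2 + 1" and cN: "enat (card N) \<le> n" and cK: "enat (card K) \<le> k"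
  show "can_separate (fibre_pairs P N K 1)"
  proof (cases "card P")
    case 0
    then have "P = {}" using fin by simp
    then show ?thesis
      using cN cK fin by (intro can_separate_of_DD[OF H0]) (auto intro: order_trans simp: zero_enat_def[symmetric] add_increasing2)
  next
    case (Suc r)
    have "enat (Suc r) = enat r + 1" by (simp add: one_enat_def)
    then have r: "enat r \<le> m1 + m2" using cP Suc by simp
    obtain p q where pq: "r = p + q" "enat p \<le> m1" "enat q \<le> m2"
    proof (cases m1)
      case (enat a)
      show ?thesis
      proof (rule that[of "min r a" "r - min r a"])
        show "enat (r - min r a) \<le> m2"
          using r enat by (cases m2) auto
      qed (use enat in auto)
    next
      case infinity
      then show ?thesis using that[of r 0] by (simp add: zero_enat_def[symmetric])
    qed
    have card_diff: "card (P - J) + card J = Suc (p + q)" if "J \<subseteq> P" for J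
      using Suc pq(1) that fin(1) by (metis card_Diff_subset card_mono finite_subset le_add_diff_inverse2)
    have Suc_le: "enat (Suc i) \<le> j + 1" if "enat i \<le> j" for i j
      using add_right_mono[OF that, of 1] by (simp add: one_enat_def)
    show ?thesis
    proof (rule can_separate_join[OF fin(1)])
      show "card P = Suc (p + q)" using Suc pq(1) by simp
      fix J b assume J: "J \<subseteq> P" "card J = Suc q"
      have finJ: "finite J" using J fin finite_subset by auto
      have cd: "card (P - J) = p" using card_diff[OF J(1)] J(2) by simp
      show "can_separate (fibre_pairs (P - J) N (K \<union> J) b)"
        using fin dis J cN cd pq finJ
        by (intro can_separate_of_DD[OF H1] enat_card_Un cK) (auto intro: Suc_le)
      fix J' assume J': "J' \<subseteq> P" "card J' = Suc p"
      have cd': "card (P - J') = q" using card_diff[OF J'(1)] J'(2) by simp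
      show "can_separate (fibre_pairs {} ((P - J) \<union> N) ((P - J') \<union> K) b)"
        unfolding Un_commute[of "P - J"] Un_commute[of "P - J'"]
        using fin J cd cd' pq
        by (intro can_separate_of_DD[OF H0] enat_card_Un cN cK) (auto simp: zero_enat_def)
    next
      fix J' b assume J': "J' \<subseteq> P" "card J' = Suc p"
      have finJ: "finite J'" using J' fin finite_subset by auto
      have cd: "card (P - J') = q" using card_diff[OF J'(1)] J'(2) by simp
      show "can_separate (fibre_pairs (P - J') (N \<union> J') K b)"
        using fin dis J' cK cd pq finJ
        by (intro can_separate_of_DD[OF H2] enat_card_Un cN) (auto intro: Suc_le)
    qed
  qed
qed

text \<open>The criterion by separation bounds cardinalities only from above, so passing through it
  discards surplus dimensions.\<close>

lemma DD_mono:
  assumes "DD_property m n k mtopology" "m' \<le> m" "n' \<le> n" "k' \<le> k"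
  shows "DD_property m' n' k' mtopology"
  by (rule DD_of_can_separate, rule can_separate_of_DD[OF assms(1)]) (use assms(2-) in \<open>auto intro: order_trans\<close>)

text \<open>\<open>H0\<close> serves twice: as the property for the 0-dimensional join factor, and,
  with one dimension dropped, for the pair of skeleta.\<close>

lemma DD_Suc:
  assumes H0: "DD_property 0 n (k + m + 1) mtopology" and H2: "DD_property m (n + 1) k mtopology"
  shows "DD_property (m + 1) n k mtopology"
proof -
  have "DD_property (0 + m + 1) n k mtopology"
  proof (rule DD_join)
    show "DD_property 0 (n + 0) (k + m) mtopology"
      by (rule DD_mono[OF H0]) auto
    show "DD_property 0 n (k + (m + 1)) mtopology" "DD_property m (n + (0 + 1)) k mtopology"
      using H0 H2 by (simp_all add: add.assoc)
  qed
  then show ?thesis by simp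
qed

text \<open>Each step trades one parameter for a dimension of the first fibre, so \<open>n\<close>
  must vary in the induction.\<close>

lemma DD_of_DD_0_finite:
  assumes "\<And>i j :: nat. i + j \<le> m \<Longrightarrow> DD_property 0 (n + enat i) (k + enat j) mtopology"
  shows "DD_property (enat m) n k mtopology"
  using assms
proof (induction m arbitrary: n)
  case 0
  show ?case using "0.prems"[of 0 0] by (simp add: zero_enat_def[symmetric])
next
  case (Suc m)
  have "DD_property (enat m + 1) n k mtopology"
  proof (rule DD_Suc)
    have "enat m + 1 = enat (Suc m)"
      by (simp add: one_enat_def)
    then show "DD_property 0 n (k + enat m + 1) mtopology"
      using Suc.prems[of 0 "Suc m"] unfolding add.assoc by (simp add: zero_enat_def[symmetric])
    show "DD_property (enat m) (n + 1) k mtopology"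
    proof (rule Suc.IH)
      fix i j :: nat assume "i + j \<le> m"
      moreover have "1 + enat i = enat (Suc i)"
        by (simp add: one_enat_def)
      ultimately show "DD_property 0 (n + 1 + enat i) (k + enat j) mtopology"
        using Suc.prems[of "Suc i" j] unfolding add.assoc by simp
    qed
  qed
  then show ?case by (simp add: one_enat_def)
qed

text \<open>Only finite \<open>P\<close> have to be treated, so even an infinite \<open>m\<close>
  reduces to the finite dimensions \<open>card P\<close>.\<close>

lemma DD_of_DD_0:
  assumes "\<And>i j :: nat. enat (i + j) < m + 1 \<Longrightarrow> DD_property 0 (n + enat i) (k + enat j) mtopology"
  shows "DD_property m n k mtopology"
proof (rule DD_of_can_separate)
  fix P N K :: "nat set"
  assume fin: "finite P" "finite N" "finite K" and dis: "P \<inter> N = {}" "P \<inter> K = {}"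
    and cP: "enat (card P) \<le> m" and card: "enat (card N) \<le> n" "enat (card K) \<le> k"
  have "DD_property (enat (card P)) n k mtopology"
  proof (rule DD_of_DD_0_finite)
    fix i j :: nat assume "i + j \<le> card P"
    then have "enat (i + j) < m + 1"
      using cP by (cases m) (auto simp: one_enat_def)
    then show "DD_property 0 (n + enat i) (k + enat j) mtopology" by (rule assms)
  qed
  then show "can_separate (fibre_pairs P N K 1)"
    by (rule can_separate_of_DD[OF _ fin dis _ card]) simp
qed

end

theorem theorem12:
  fixes X :: "'a topology" and n k m m1 m2 :: enat
  assumes "metrizable_space X"
  shows "(m = m1 + m2 + 1 \<and>
          DD_property 0 (n + m1) (k + m2) X \<and>
          DD_property m1 n (k + (m2 + 1)) X \<and>
          DD_property m2 (n + (m1 + 1)) k X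
            \<longrightarrow> DD_property m n k X) \<and>
         (DD_property 0 n (k + m + 1) X \<and>
          DD_property m (n + 1) k X
            \<longrightarrow> DD_property (m + 1) n k X) \<and>
         ((\<forall>i j :: nat. enat (i + j) < m + 1 \<longrightarrow> DD_property 0 (n + enat i) (k + enat j) X)
            \<longrightarrow> DD_property m n k X)"
proof -
  obtain M d where "Metric_space M d" and X: "X = Metric_space.mtopology M d"
    using assms unfolding metrizable_space_def by blast
  then interpret Metric_space M d by blast
  show ?thesis
    unfolding X using DD_join DD_Suc DD_of_DD_0 by blast
qed

end
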